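(* Let $d_A,d_R,n$ be positive integers, let $\hat{\sigma}_A$ be a positive semidefinite operator on $\mathbb{C}^{d_A}$, and let $\rho_{A^nR^n}$ be any purification of $(\hat{\sigma}_A)^{\otimes n}$ that is supported on the symmetric subspace $\mathrm{Sym}^n(\mathbb{C}^{d_A}\otimes\mathbb{C}^{d_R})$. Then there exists a probability measure $\mathrm{d}\phi$ on the set of purifications $|\phi\rangle\langle\phi|_{AR}\in\mathbb{C}^{d_A}\otimes\mathbb{C}^{d_R}$ of $\hat{\sigma}_A$ such that $$\rho_{A^nR^n}\leq g_{n,d_Ad_R}\int |\phi\rangle\langle\phi|_{AR}^{\otimes n}\,\mathrm{d}\phi .$$
   Context: For a finite-dimensional Hilbert space $V$, $\mathrm{Sym}^n(V)\subseteq V^{\otimes n}$ denotes the symmetric subspace (vectors invariant under all permutations of the $n$ tensor factors); here $V=\mathbb{C}^{d_A}\otimes\mathbb{C}^{d_R}$ and $(\mathbb{C}^{d_A}\otimes\mathbb{C}^{d_R})^{\otimes n}$ is identified with $A^nR^n$. For positive integers $n,x$, $g_{n,x}:=\dim\mathrm{Sym}^n(\mathbb{C}^x)=\binom{n+x-1}{n}$. A purification of a positive operator $P$ on $A$ is a rank-one positive operator $|\psi\rangle\langle\psi|$ on $A\otimes R$ with $\mathrm{Tr}_R|\psi\rangle\langle\psi|=P$. The operator inequality $\leq$ is in the positive semidefinite order. *)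

theory Defs
  imports "HOL-Analysis.Analysis" "HOL-Library.Complex_Order" "HOL-Combinatorics.Permutations" "HOL-Probability.Probability"
begin

text \<open>Operators on a finite-dimensional space with orthonormal basis indexed by a set I are
  represented as matrices I x I -> complex (functions i j). Positive semidefinite:
  the quadratic form v* M v is a nonnegative real for every v.\<close>
definition psd_on :: "'i set \<Rightarrow> ('i \<Rightarrow> 'i \<Rightarrow> complex) \<Rightarrow> bool" where
  "psd_on I M \<longleftrightarrow> (\<forall>v :: 'i \<Rightarrow> complex. 0 \<le> (\<Sum>i\<in>I. \<Sum>j\<in>I. cnj (v i) * M i j * v j))"

text \<open>Basis indices of the n-fold tensor power: lists of length n.\<close>
definition idx :: "nat \<Rightarrow> 'i list set" where
  "idx n = {xs. length xs = n}"

definition tpow :: "nat \<Rightarrow> ('i \<Rightarrow> 'i \<Rightarrow> complex) \<Rightarrow> 'i list \<Rightarrow> 'i list \<Rightarrow> complex" where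
  "tpow n S xs ys = (\<Prod>k<n. S (xs ! k) (ys ! k))"

definition outer1 :: "complex ^ ('a::finite \<times> 'r::finite) \<Rightarrow> ('a \<times> 'r) \<Rightarrow> ('a \<times> 'r) \<Rightarrow> complex" where
  "outer1 \<phi> x y = (\<phi> $ x) * cnj (\<phi> $ y)"

text \<open>|phi><phi| (phi nonzero, so rank one) is a purification of P: Tr_R |phi><phi| = P.\<close>
definition purification1 :: "('a::finite \<Rightarrow> 'a \<Rightarrow> complex) \<Rightarrow> complex ^ ('a \<times> 'r::finite) \<Rightarrow> bool" where
  "purification1 P \<phi> \<longleftrightarrow> \<phi> \<noteq> 0 \<and>
     (\<forall>a a'. (\<Sum>r\<in>UNIV. \<phi> $ (a, r) * cnj (\<phi> $ (a', r))) = P a a')"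

definition ptrace_Rn :: "nat \<Rightarrow> (('a \<times> 'r::finite) list \<Rightarrow> ('a \<times> 'r) list \<Rightarrow> complex)
    \<Rightarrow> 'a list \<Rightarrow> 'a list \<Rightarrow> complex" where
  "ptrace_Rn n \<rho> as bs = (\<Sum>rs\<in>idx n. \<rho> (zip as rs) (zip bs rs))"

definition purification_n :: "nat \<Rightarrow> ('a::finite \<Rightarrow> 'a \<Rightarrow> complex)
    \<Rightarrow> (('a \<times> 'r::finite) list \<Rightarrow> ('a \<times> 'r) list \<Rightarrow> complex) \<Rightarrow> bool" where
  "purification_n n P \<rho> \<longleftrightarrow>
     (\<exists>\<psi> :: ('a \<times> 'r) list \<Rightarrow> complex. (\<exists>i\<in>idx n. \<psi> i \<noteq> 0) \<and>
        (\<forall>i\<in>idx n. \<forall>j\<in>idx n. \<rho> i j = \<psi> i * cnj (\<psi> j))) \<and>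
     (\<forall>as\<in>idx n. \<forall>bs\<in>idx n. ptrace_Rn n \<rho> as bs = tpow n P as bs)"

definition in_sym :: "nat \<Rightarrow> ('i list \<Rightarrow> complex) \<Rightarrow> bool" where
  "in_sym n v \<longleftrightarrow> (\<forall>xs\<in>idx n. \<forall>p. p permutes {..<n} \<longrightarrow> v (map (\<lambda>k. xs ! p k) [0..<n]) = v xs)"

text \<open>An operator is supported on Sym^n: its range (spanned by its columns) lies in Sym^n.\<close>
definition supported_on_sym :: "nat \<Rightarrow> ('i list \<Rightarrow> 'i list \<Rightarrow> complex) \<Rightarrow> bool" where
  "supported_on_sym n \<rho> \<longleftrightarrow> (\<forall>j\<in>idx n. in_sym n (\<lambda>i. \<rho> i j))"

text \<open>g_{n,x} = dim Sym^n(C^x) = binom(n+x-1, n).\<close>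
definition g :: "nat \<Rightarrow> nat \<Rightarrow> nat" where
  "g n x = (n + x - 1) choose n"

end

theory Submission
  imports Defs "HOL-Computational_Algebra.Polynomial"
begin

text \<open>A vector \<open>\<phi>\<close> in \<open>A \<otimes> R\<close> is a matrix \<open>\<Phi>\<close> with \<open>\<phi>\<close> purifying \<open>\<sigma>\<close> iff \<open>\<Phi> \<Phi>\<^sup>* = \<sigma>\<close>; these \<open>\<phi>\<close>
  form a compact set \<open>K\<close>. Among all mixtures \<open>M\<close> of the operators \<open>|\<phi>\<rangle>\<langle>\<phi>|\<close> to the tensor power
  \<open>n\<close>, \<open>\<phi> \<in> K\<close>, take the one of least Frobenius norm, which exists by Caratheodory's theorem and
  compactness. It is unique, hence invariant under every unitary \<open>U\<^bsup>\<otimes>n\<^esup>\<close> on \<open>R\<^sup>n\<close>; this replaces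
  the Haar average.

  By the commutant half of Schur--Weyl duality the \<open>R\<^sup>n\<close>-blocks of \<open>M\<close> commute with all
  permutation-invariant operators on \<open>R\<^sup>n\<close>. For any \<open>\<phi> \<in> K\<close>, a symmetric purification \<open>\<psi>\<close> of
  \<open>\<sigma>\<^bsup>\<otimes>n\<^esup>\<close> has the form \<open>\<Phi>\<^bsup>\<otimes>n\<^esup> W\<close> with a permutation-invariant partial isometry \<open>W\<close>, so a bound
  \<open>|\<phi>\<rangle>\<langle>\<phi>|\<^bsup>\<otimes>n\<^esup> \<le> c M\<close> for a single \<open>\<phi> \<in> K\<close> already gives \<open>|\<psi>\<rangle>\<langle>\<psi>| \<le> c M\<close>. Finally, the average over
  \<open>M\<close> of \<open>\<langle>\<phi>\<^bsup>\<otimes>n\<^esup>, M\<^sup>+ \<phi>\<^bsup>\<otimes>n\<^esup>\<rangle>\<close>, with \<open>M\<^sup>+\<close> the pseudoinverse, is the rank of \<open>M\<close>, which is at most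
  the dimension of the symmetric subspace; so some atom \<open>\<phi>\<close> of the mixture admits that dimension
  as \<open>c\<close>.\<close>

section \<open>Linear systems and positive semidefinite forms\<close>

text \<open>Gaussian elimination by induction on the equations: an equation with a nonzero
  coefficient at \<open>p\<close> serves to eliminate the unknown \<open>p\<close> from all others,
  which leaves one equation and one unknown fewer.\<close>

lemma exists_nontrivial_solution:
  fixes a :: "'e \<Rightarrow> 'k \<Rightarrow> 'f::field"
  assumes "finite E" "finite S" "card E < card S"
  shows "\<exists>x. (\<exists>k\<in>S. x k \<noteq> 0) \<and> (\<forall>e\<in>E. (\<Sum>k\<in>S. a e k * x k) = 0)"
  using assms
proof (induction E arbitrary: S a rule: finite_induct)
  case empty
  then have "S \<noteq> {}" by auto
  then show ?case by (intro exI[of _ "\<lambda>_. 1"]) auto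
next
  case (insert e E)
  show ?case
  proof (cases "\<forall>k\<in>S. a e k = 0")
    case True
    have "card E < card S" using insert by simp
    from insert.IH[OF insert.prems(1) this, of a] obtain x where
      "\<exists>k\<in>S. x k \<noteq> 0" "\<forall>e\<in>E. (\<Sum>k\<in>S. a e k * x k) = 0" by auto
    with True show ?thesis by (intro exI[of _ x]) auto
  next
    case False
    then obtain p where p: "p \<in> S" "a e p \<noteq> 0" by auto
    define b where "b = (\<lambda>d k. a d k - a d p * a e k / a e p)"
    from insert p have "card E < card (S - {p})" by simp
    from insert.IH[OF _ this, of b] insert obtain x where
      x: "\<exists>k\<in>S-{p}. x k \<noteq> 0" "\<forall>d\<in>E. (\<Sum>k\<in>S-{p}. b d k * x k) = 0" by auto
    \<comment> \<open>The value of the eliminated unknown that equation \<open>e\<close>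
      forces.\<close>
    define t where "t = - (\<Sum>k\<in>S-{p}. a e k * x k) / a e p"
    define y where "y = x(p := t)"
    have split: "(\<Sum>k\<in>S. a d k * y k) = a d p * t + (\<Sum>k\<in>S-{p}. a d k * x k)" for d
    proof -
      have "(\<Sum>k\<in>S. a d k * y k) = a d p * y p + (\<Sum>k\<in>S-{p}. a d k * y k)"
        using insert.prems p by (simp add: sum.remove)
      also have "(\<Sum>k\<in>S-{p}. a d k * y k) = (\<Sum>k\<in>S-{p}. a d k * x k)"
        by (rule sum.cong) (auto simp: y_def)
      finally show ?thesis by (simp add: y_def)
    qed
    have "(\<Sum>k\<in>S. a d k * y k) = 0" if d: "d \<in> insert e E" for d
    proof (cases "d = e")
      case True
      then show ?thesis using p by (simp add: split t_def)
    next
      case False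
      then have "d \<in> E" using d by simp
      then have "0 = (\<Sum>k\<in>S-{p}. b d k * x k)" using x by simp
      also have "\<dots> = (\<Sum>k\<in>S-{p}. a d k * x k) - a d p / a e p * (\<Sum>k\<in>S-{p}. a e k * x k)"
        by (simp add: b_def algebra_simps sum_subtractf sum_distrib_left)
      finally show ?thesis unfolding split t_def by simp
    qed
    moreover have "\<exists>k\<in>S. y k \<noteq> 0" using x by (auto simp: y_def)
    ultimately show ?thesis by blast
  qed
qed

text \<open>While there are more vectors than coordinates, a linear dependence among them can be
  subtracted from the weights until one weight vanishes. The total weight is not preserved
  automatically; it has to be supplied as a coordinate.\<close>

lemma conic_caratheodory:
  fixes a :: "'e \<Rightarrow> 'k \<Rightarrow> real"
  assumes "finite E" "finite S" "\<forall>k\<in>S. 0 \<le> w k"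
  shows "\<exists>T v. T \<subseteq> S \<and> card T \<le> card E \<and> (\<forall>k\<in>T. 0 \<le> v k) \<and>
           (\<forall>e\<in>E. (\<Sum>k\<in>T. v k * a e k) = (\<Sum>k\<in>S. w k * a e k))"
  using assms(2,3)
proof (induction "card S" arbitrary: S w rule: less_induct)
  case less
  show ?case
  proof (cases "card S \<le> card E")
    case True
    then show ?thesis using less by blast
  next
    case False
    then obtain x0 where x0: "\<exists>k\<in>S. x0 k \<noteq> 0" "\<forall>e\<in>E. (\<Sum>k\<in>S. a e k * x0 k) = 0"
      using exists_nontrivial_solution[OF assms(1) less.prems(1), of a] by auto
    then obtain k0 where k0: "k0 \<in> S" "x0 k0 \<noteq> 0" by auto
    \<comment> \<open>The sign is chosen so that the dependence has a positive entry, which makes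
      \<open>P\<close> nonempty.\<close>
    define x where "x = (\<lambda>k. sgn (x0 k0) * x0 k)"
    have xk0: "x k0 > 0" using k0 by (simp add: x_def sgn_if)
    have x: "(\<Sum>k\<in>S. x k * a e k) = 0" if "e \<in> E" for e
    proof -
      have "(\<Sum>k\<in>S. x k * a e k) = sgn (x0 k0) * (\<Sum>k\<in>S. a e k * x0 k)"
        by (simp add: x_def sum_distrib_left mult_ac)
      then show ?thesis using x0 that by simp
    qed
    define P where "P = {k\<in>S. x k > 0}"
    have P: "finite P" "P \<noteq> {}" using less.prems k0 xk0 by (auto simp: P_def)
    \<comment> \<open>The largest multiple of \<open>x\<close> that can be subtracted with all
      weights staying nonnegative; the weight of a minimizing \<open>p\<close> becomes zero.\<close>
    define t where "t = Min ((\<lambda>k. w k / x k) ` P)"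
    have "t \<in> (\<lambda>k. w k / x k) ` P" unfolding t_def using P by (intro Min_in) auto
    then obtain p where p: "p \<in> P" "t = w p / x p" by auto
    have tle: "t \<le> w k / x k" if "k \<in> P" for k unfolding t_def using P that by (intro Min_le) auto
    have t0: "t \<ge> 0" using p less.prems by (auto simp: P_def)
    define v where "v = (\<lambda>k. w k - t * x k)"
    have v0: "0 \<le> v k" if "k \<in> S" for k
    proof (cases "k \<in> P")
      case True
      then show ?thesis using tle[OF True] by (auto simp: v_def P_def field_simps)
    next
      case False
      then have "t * x k \<le> 0" using that t0 by (intro mult_nonneg_nonpos) (auto simp: P_def)
      then show ?thesis using less.prems that by (simp add: v_def) (smt (verit))
    qed
    have vp: "v p = 0" using p by (auto simp: v_def P_def)
    have pS: "p \<in> S" using p by (auto simp: P_def)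
    have "card (S - {p}) < card S" using pS less.prems by (intro card_Diff1_less)
    moreover have "finite (S - {p})" "\<forall>k\<in>S-{p}. 0 \<le> v k" using less.prems v0 by auto
    ultimately obtain T u where
      T: "T \<subseteq> S - {p}" "card T \<le> card E" "\<forall>k\<in>T. 0 \<le> u k"
         "\<forall>e\<in>E. (\<Sum>k\<in>T. u k * a e k) = (\<Sum>k\<in>S-{p}. v k * a e k)"
      using less.hyps[of "S - {p}" v] by blast
    have "(\<Sum>k\<in>S-{p}. v k * a e k) = (\<Sum>k\<in>S. w k * a e k)" if "e \<in> E" for e
    proof -
      have "(\<Sum>k\<in>S. v k * a e k) = v p * a e p + (\<Sum>k\<in>S-{p}. v k * a e k)"
        using pS less.prems by (simp add: sum.remove)
      moreover have "(\<Sum>k\<in>S. v k * a e k) = (\<Sum>k\<in>S. w k * a e k) - t * (\<Sum>k\<in>S. x k * a e k)"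
        by (simp add: v_def algebra_simps sum_subtractf sum_distrib_left)
      ultimately show ?thesis using x[OF that] vp by simp
    qed
    with T show ?thesis by (intro exI[of _ T] exI[of _ u]) auto
  qed
qed

section \<open>Sesquilinear forms and maximal orthonormal systems\<close>

definition sesq_form :: "'i set \<Rightarrow> ('i \<Rightarrow> 'i \<Rightarrow> complex) \<Rightarrow> ('i \<Rightarrow> complex) \<Rightarrow> ('i \<Rightarrow> complex) \<Rightarrow> complex" where
  "sesq_form I S x y = (\<Sum>i\<in>I. \<Sum>j\<in>I. cnj (x i) * S i j * y j)"

lemma sesq_form_add_right: "sesq_form I S x (\<lambda>i. y i + z i) = sesq_form I S x y + sesq_form I S x z"
  by (simp add: sesq_form_def algebra_simps sum.distrib)

lemma sesq_form_add_left: "sesq_form I S (\<lambda>i. y i + z i) x = sesq_form I S y x + sesq_form I S z x"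
  by (simp add: sesq_form_def algebra_simps sum.distrib)

lemma sesq_form_diff_right: "sesq_form I S x (\<lambda>i. y i - z i) = sesq_form I S x y - sesq_form I S x z"
  by (simp add: sesq_form_def algebra_simps sum_subtractf)

lemma sesq_form_diff_left: "sesq_form I S (\<lambda>i. y i - z i) x = sesq_form I S y x - sesq_form I S z x"
  by (simp add: sesq_form_def algebra_simps sum_subtractf)

lemma sesq_form_scale_right: "sesq_form I S x (\<lambda>i. c * y i) = c * sesq_form I S x y"
  by (simp add: sesq_form_def sum_distrib_left mult_ac)

lemma sesq_form_scale_left: "sesq_form I S (\<lambda>i. c * y i) x = cnj c * sesq_form I S y x"
  by (simp add: sesq_form_def sum_distrib_left mult_ac)

lemma sesq_form_sum_right:
  "finite K \<Longrightarrow> sesq_form I S x (\<lambda>i. \<Sum>k\<in>K. c k * y k i) = (\<Sum>k\<in>K. c k * sesq_form I S x (y k))"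
proof (induction K rule: finite_induct)
  case empty
  then show ?case by (simp add: sesq_form_def)
qed (simp add: sesq_form_add_right sesq_form_scale_right)

lemma psd_onD: "psd_on I S \<Longrightarrow> 0 \<le> sesq_form I S x x"
  by (simp add: psd_on_def sesq_form_def)

text \<open>Polarization: the quadratic form is real at \<open>x + y\<close> and at
  \<open>x + \<i> * y\<close>, which fixes the imaginary and the real part of the claim.\<close>

lemma psd_sesq_form_herm:
  assumes "psd_on I S"
  shows "sesq_form I S y x = cnj (sesq_form I S x y)"
proof -
  let ?B = "sesq_form I S"
  have im: "Im (?B z z) = 0" for z using psd_onD[OF assms, of z] by (simp add: less_eq_complex_def)
  have "?B (\<lambda>i. x i + y i) (\<lambda>i. x i + y i) = ?B x x + ?B y y + (?B x y + ?B y x)"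
    by (simp add: sesq_form_add_left sesq_form_add_right)
  then have 1: "Im (?B x y) + Im (?B y x) = 0" using im by (metis add.left_neutral plus_complex.simps(2))
  have "?B (\<lambda>i. x i + \<i> * y i) (\<lambda>i. x i + \<i> * y i) = ?B x x + ?B y y + \<i> * (?B x y - ?B y x)"
    by (simp add: sesq_form_add_left sesq_form_add_right sesq_form_scale_left sesq_form_scale_right algebra_simps)
  then have "Im (\<i> * (?B x y - ?B y x)) = 0" using im by (metis add.left_neutral plus_complex.simps(2))
  then have 2: "Re (?B x y) = Re (?B y x)" by simp
  from 1 2 show ?thesis by (simp add: complex_eq_iff)
qed

text \<open>The degenerate case of the Cauchy-Schwarz inequality: if the null vector
  \<open>x\<close> paired nontrivially with \<open>y\<close>, adding a suitable multiple of
  \<open>x\<close> to \<open>y\<close> would make the quadratic form negative.\<close>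

lemma psd_sesq_form_null:
  assumes "psd_on I S" "sesq_form I S x x = 0"
  shows "sesq_form I S y x = 0"
proof (rule ccontr)
  let ?B = "sesq_form I S"
  assume n: "?B y x \<noteq> 0"
  define s where "s = Re (?B y y) + 1"
  have s: "s > 0" using psd_onD[OF assms(1), of y] by (simp add: s_def less_eq_complex_def)
  define b where "b = ?B y x"
  have h: "?B x y = cnj b" unfolding b_def by (rule psd_sesq_form_herm[OF assms(1)])
  define N where "N = (cmod b)\<^sup>2"
  have N: "b * cnj b = of_real N" "N \<noteq> 0"
    using n complex_norm_square[of b] by (simp_all add: N_def b_def)
  \<comment> \<open>With this \<open>c\<close> both cross terms equal \<open>-s\<close>, so the form
    at \<open>y + c x\<close> is its value at \<open>y\<close> minus \<open>2 * s\<close>, which is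
    negative.\<close>
  define c where "c = - of_real (s / N) * cnj b"
  let ?z = "\<lambda>i. y i + c * x i"
  have "?B ?z ?z = ?B y y + c * b + cnj c * cnj b"
    by (simp add: sesq_form_add_left sesq_form_add_right sesq_form_scale_left sesq_form_scale_right assms h
        flip: b_def)
  also have "c * b = - of_real (s / N) * (b * cnj b)"
    by (simp add: c_def)
  also have "cnj c * cnj b = - of_real (s / N) * (b * cnj b)"
    by (simp add: c_def)
  also have "- of_real (s / N) * (b * cnj b) = - of_real s"
    unfolding N(1) using N(2) by simp
  finally have "Re (?B ?z ?z) = Re (?B y y) - 2 * s" by simp
  also have "\<dots> < 0" using s by (simp add: s_def)
  finally show False using psd_onD[OF assms(1), of ?z] by (simp add: less_eq_complex_def)
qed

text \<open>Orthonormality refers to the possibly degenerate form \<open>S\<close>. Over a finite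
  index set the greatest length of such a system is the rank of \<open>S\<close>, so these systems
  stand in for a spectral decomposition.\<close>

definition orthonormal :: "'i set \<Rightarrow> ('i \<Rightarrow> 'i \<Rightarrow> complex) \<Rightarrow> nat \<Rightarrow> (nat \<Rightarrow> 'i \<Rightarrow> complex) \<Rightarrow> bool" where
  "orthonormal I S m e \<longleftrightarrow> (\<forall>k<m. \<forall>l<m. sesq_form I S (e k) (e l) = of_bool (k = l))"

text \<open>Take a system of greatest length. The Gram-Schmidt residual of any \<open>x\<close> is
  orthogonal to it; were its form value positive, the normalized residual would extend the system.
  So the residual is null and pairs to zero with every vector.\<close>

lemma psd_maximal_orthonormal_system:
  assumes psd: "psd_on I S" and bound: "\<And>m e. orthonormal I S m e \<Longrightarrow> m \<le> D"
  obtains m e where "m \<le> D" "orthonormal I S m e"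
    "\<And>x y. sesq_form I S y (\<lambda>i. x i - (\<Sum>k<m. sesq_form I S (e k) x * e k i)) = 0"
proof -
  let ?B = "sesq_form I S"
  define Q where "Q = (\<lambda>m. \<exists>e. orthonormal I S m e)"
  have "Q 0" by (auto simp: Q_def orthonormal_def)
  moreover have bd: "\<forall>m. Q m \<longrightarrow> m \<le> D" unfolding Q_def using bound by blast
  ultimately have G: "Q (Greatest Q)" using GreatestI_nat[of Q 0 D] by blast
  define m where "m = Greatest Q"
  obtain e where e: "orthonormal I S m e" using G by (auto simp: Q_def m_def)
  have mD: "m \<le> D" using bd G by (auto simp: m_def)
  have nQ: "\<not> Q (Suc m)"
  proof
    assume "Q (Suc m)"
    then have "Suc m \<le> Greatest Q" using bd by (intro Greatest_le_nat) auto
    then show False by (simp add: m_def)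
  qed
  have "?B y (\<lambda>i. x i - (\<Sum>k<m. ?B (e k) x * e k i)) = 0" for x y
  proof -
    define z where "z = (\<lambda>i. x i - (\<Sum>k<m. ?B (e k) x * e k i))"
    have ez: "?B (e k) z = 0" if "k < m" for k
    proof -
      have "?B (e k) z = ?B (e k) x - (\<Sum>l<m. ?B (e l) x * ?B (e k) (e l))"
        by (simp add: z_def sesq_form_diff_right sesq_form_sum_right)
      also have "(\<Sum>l<m. ?B (e l) x * ?B (e k) (e l)) = (\<Sum>l<m. if l = k then ?B (e l) x else 0)"
        using e that by (intro sum.cong) (auto simp: orthonormal_def)
      finally show ?thesis using that by simp
    qed
    have ze: "?B z (e k) = 0" if "k < m" for k
      using psd_sesq_form_herm[OF psd, of z "e k"] ez[OF that] by simp
    have "?B z z = 0"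
    proof (rule ccontr)
      assume nz: "?B z z \<noteq> 0"
      define s where "s = Re (?B z z)"
      have Bs: "?B z z = of_real s" and s: "s > 0"
        using psd_onD[OF psd, of z] nz by (auto simp: s_def less_eq_complex_def complex_eq_iff)
      define u where "u = (\<lambda>i. of_real (1 / sqrt s) * z i)"
      have "?B u u = of_real (1 / sqrt s * (1 / sqrt s) * s)"
        unfolding u_def sesq_form_scale_left sesq_form_scale_right Bs by (simp flip: of_real_mult)
      also have "1 / sqrt s * (1 / sqrt s) * s = 1" using s by (simp add: field_simps)
      finally have uu: "?B u u = 1" by simp
      have eu: "?B (e k) u = 0" "?B u (e k) = 0" if "k < m" for k
        unfolding u_def sesq_form_scale_left sesq_form_scale_right using ez[OF that] ze[OF that] by auto
      have "orthonormal I S (Suc m) (e(m := u))"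
        using e uu eu by (auto simp: orthonormal_def less_Suc_eq)
      then show False using nQ by (auto simp: Q_def)
    qed
    then show ?thesis using psd_sesq_form_null[OF psd] by (simp add: z_def)
  qed
  from that[OF mD e this] show thesis .
qed

section \<open>Matrices on tensor powers\<close>

text \<open>Row and column types may differ, and the summation set is explicit because indices of
  tensor powers are lists of one fixed length. Identities between such matrices are often available
  only on these index sets.\<close>

definition mat_mul :: "'k set \<Rightarrow> ('x \<Rightarrow> 'k \<Rightarrow> complex) \<Rightarrow> ('k \<Rightarrow> 'y \<Rightarrow> complex) \<Rightarrow> 'x \<Rightarrow> 'y \<Rightarrow> complex" where
  "mat_mul I A B x y = (\<Sum>k\<in>I. A x k * B k y)"

definition adj :: "('x \<Rightarrow> 'y \<Rightarrow> complex) \<Rightarrow> 'y \<Rightarrow> 'x \<Rightarrow> complex" where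
  "adj A y x = cnj (A x y)"

definition id_mat :: "'x \<Rightarrow> 'x \<Rightarrow> complex" where
  "id_mat x y = of_bool (x = y)"

text \<open>The rectangular version of \<open>tpow\<close>, needed for powers of maps between the
  spaces R and A.\<close>

definition tensor_mat :: "nat \<Rightarrow> ('x \<Rightarrow> 'y \<Rightarrow> complex) \<Rightarrow> 'x list \<Rightarrow> 'y list \<Rightarrow> complex" where
  "tensor_mat n A xs ys = (\<Prod>k<n. A (xs ! k) (ys ! k))"

lemma tpow_eq_tensor_mat: "tpow = tensor_mat"
  by (auto simp: tpow_def tensor_mat_def fun_eq_iff)

lemma mat_mul_assoc: "mat_mul J (mat_mul I A B) C = mat_mul I A (mat_mul J B C)"
proof (intro ext)
  fix x y
  have "mat_mul J (mat_mul I A B) C x y = (\<Sum>j\<in>J. \<Sum>i\<in>I. A x i * (B i j * C j y))"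
    by (simp add: mat_mul_def sum_distrib_right mult.assoc)
  also have "\<dots> = (\<Sum>i\<in>I. \<Sum>j\<in>J. A x i * (B i j * C j y))" by (rule sum.swap)
  finally show "mat_mul J (mat_mul I A B) C x y = mat_mul I A (mat_mul J B C) x y"
    by (simp add: mat_mul_def sum_distrib_left)
qed

lemma mat_mul_cong:
  assumes "\<And>k. k \<in> I \<Longrightarrow> A x k = A' x k" "\<And>k. k \<in> I \<Longrightarrow> B k y = B' k y"
  shows "mat_mul I A B x y = mat_mul I A' B' x y"
  unfolding mat_mul_def using assms by (intro sum.cong) auto

lemma mat_mul_id_mat_left [simp]: "finite I \<Longrightarrow> x \<in> I \<Longrightarrow> mat_mul I id_mat A x y = A x y"
  by (simp add: mat_mul_def id_mat_def of_bool_def if_distrib[of "\<lambda>x. x * _"] cong: if_cong)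

lemma mat_mul_id_mat_right [simp]: "finite I \<Longrightarrow> y \<in> I \<Longrightarrow> mat_mul I A id_mat x y = A x y"
  by (simp add: mat_mul_def id_mat_def of_bool_def if_distrib[of "\<lambda>x. _ * x"] cong: if_cong)

lemma adj_adj [simp]: "adj (adj A) = A"
  by (simp add: adj_def fun_eq_iff)

lemma adj_mat_mul: "adj (mat_mul I A B) = mat_mul I (adj B) (adj A)"
  by (simp add: adj_def mat_mul_def fun_eq_iff mult.commute)

lemma adj_id_mat [simp]: "adj id_mat = id_mat"
  by (auto simp: adj_def id_mat_def fun_eq_iff)

lemma adj_tensor_mat: "adj (tensor_mat n A) = tensor_mat n (adj A)"
  by (simp add: adj_def tensor_mat_def fun_eq_iff)

lemma finite_idx [simp]: "finite (idx n :: 'i::finite list set)"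
  using finite_lists_length_eq[of "UNIV :: 'i set" n] by (simp add: idx_def)

lemma card_idx: "card (idx n :: 'i::finite list set) = CARD('i) ^ n"
  using card_lists_length_eq[of "UNIV :: 'i set" n] by (simp add: idx_def)

lemma sum_idx_prod:
  fixes f :: "nat \<Rightarrow> 'i::finite \<Rightarrow> 'b::comm_semiring_1"
  shows "(\<Sum>xs\<in>idx n. \<Prod>k<n. f k (xs ! k)) = (\<Prod>k<n. \<Sum>x\<in>UNIV. f k x)"
proof (induction n arbitrary: f)
  case 0
  then show ?case by (simp add: idx_def)
next
  case (Suc n)
  have idx_Suc: "idx (Suc n) = (\<lambda>(x, xs). x # xs) ` (UNIV \<times> idx n)"
    by (auto simp: idx_def length_Suc_conv)
  have inj: "inj_on (\<lambda>(x, xs). x # xs) (UNIV \<times> idx n)" by (auto simp: inj_on_def)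
  have "(\<Sum>xs\<in>idx (Suc n). \<Prod>k<Suc n. f k (xs ! k))
      = (\<Sum>(x, xs)\<in>UNIV \<times> idx n. f 0 x * (\<Prod>k<n. f (Suc k) (xs ! k)))"
    unfolding idx_Suc sum.reindex[OF inj]
    by (intro sum.cong) (auto simp: prod.lessThan_Suc_shift simp del: prod.lessThan_Suc)
  also have "\<dots> = (\<Sum>x\<in>UNIV. f 0 x) * (\<Sum>xs\<in>idx n. \<Prod>k<n. f (Suc k) (xs ! k))"
    by (simp add: sum_product sum.cartesian_product)
  also have "\<dots> = (\<Prod>k<Suc n. \<Sum>x\<in>UNIV. f k x)"
    by (simp add: Suc.IH[of "\<lambda>k. f (Suc k)"] prod.lessThan_Suc_shift del: prod.lessThan_Suc)
  finally show ?case .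
qed

lemma mat_mul_tensor_mat:
  fixes A :: "'x \<Rightarrow> 'k::finite \<Rightarrow> complex"
  shows "mat_mul (idx n) (tensor_mat n A) (tensor_mat n B) = tensor_mat n (mat_mul UNIV A B)"
proof (intro ext)
  fix xs ys
  show "mat_mul (idx n) (tensor_mat n A) (tensor_mat n B) xs ys = tensor_mat n (mat_mul UNIV A B) xs ys"
    using sum_idx_prod[of "\<lambda>k z. A (xs ! k) z * B z (ys ! k)" n]
    by (simp add: mat_mul_def tensor_mat_def prod.distrib)
qed

lemma tensor_mat_scaled_id_mat:
  assumes "xs \<in> idx n" "ys \<in> idx n"
  shows "tensor_mat n (\<lambda>r s. t * id_mat r s) xs ys = t ^ n * id_mat xs ys"
proof (cases "xs = ys")
  case True
  then show ?thesis by (simp add: tensor_mat_def id_mat_def)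
next
  case False
  then obtain k where k: "k < n" "xs ! k \<noteq> ys ! k"
    using assms by (auto simp: idx_def list_eq_iff_nth_eq)
  then have "tensor_mat n (\<lambda>r s. t * id_mat r s) xs ys = 0"
    by (auto simp: tensor_mat_def id_mat_def intro!: prod_zero)
  then show ?thesis using False by (simp add: id_mat_def)
qed

lemma tensor_mat_id_mat: "xs \<in> idx n \<Longrightarrow> ys \<in> idx n \<Longrightarrow> tensor_mat n id_mat xs ys = id_mat xs ys"
  using tensor_mat_scaled_id_mat[of xs n ys 1] by simp

section \<open>Operators commuting with tensor powers\<close>

definition commutes :: "nat \<Rightarrow> ('r list \<Rightarrow> 'r list \<Rightarrow> complex) \<Rightarrow> ('r list \<Rightarrow> 'r list \<Rightarrow> complex) \<Rightarrow> bool" where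
  "commutes n N B \<longleftrightarrow> (\<forall>xs\<in>idx n. \<forall>ys\<in>idx n. mat_mul (idx n) B N xs ys = mat_mul (idx n) N B xs ys)"

lemma commutes_tensor_mat_mat_mul:
  fixes X Y :: "'r::finite \<Rightarrow> 'r \<Rightarrow> complex"
  assumes "commutes n N (tensor_mat n X)" "commutes n N (tensor_mat n Y)"
  shows "commutes n N (tensor_mat n (mat_mul UNIV X Y))"
  unfolding commutes_def
proof (intro ballI)
  fix xs ys :: "'r list" assume xy: "xs \<in> idx n" "ys \<in> idx n"
  let ?I = "idx n :: 'r list set"
  let ?X = "tensor_mat n X" and ?Y = "tensor_mat n Y"
  have "mat_mul ?I (tensor_mat n (mat_mul UNIV X Y)) N xs ys = mat_mul ?I ?X (mat_mul ?I ?Y N) xs ys"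
    by (simp add: mat_mul_assoc flip: mat_mul_tensor_mat)
  also have "\<dots> = mat_mul ?I ?X (mat_mul ?I N ?Y) xs ys"
    by (rule mat_mul_cong) (use assms xy in \<open>auto simp: commutes_def\<close>)
  also have "\<dots> = mat_mul ?I (mat_mul ?I ?X N) ?Y xs ys" by (simp add: mat_mul_assoc)
  also have "\<dots> = mat_mul ?I (mat_mul ?I N ?X) ?Y xs ys"
    by (rule mat_mul_cong) (use assms xy in \<open>auto simp: commutes_def\<close>)
  also have "\<dots> = mat_mul ?I N (tensor_mat n (mat_mul UNIV X Y)) xs ys"
    by (simp add: mat_mul_assoc flip: mat_mul_tensor_mat)
  finally show "mat_mul ?I (tensor_mat n (mat_mul UNIV X Y)) N xs ys = mat_mul ?I N (tensor_mat n (mat_mul UNIV X Y)) xs ys" .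
qed

text \<open>Each entry of the commutator is a polynomial in \<open>z\<close>; with infinitely many
  zeros it vanishes identically. This is the device by which unitarity and invertibility conditions
  are removed below.\<close>

lemma commutes_tensor_mat_poly:
  fixes P :: "'r::finite \<Rightarrow> 'r \<Rightarrow> complex poly"
  assumes "infinite Z" "\<And>z. z \<in> Z \<Longrightarrow> commutes n N (tensor_mat n (\<lambda>r s. poly (P r s) z))"
  shows "commutes n N (tensor_mat n (\<lambda>r s. poly (P r s) z))"
  unfolding commutes_def
proof (intro ballI)
  fix xs ys :: "'r list" assume xy: "xs \<in> idx n" "ys \<in> idx n"
  define q where "q = (\<Sum>t\<in>idx n. (\<Prod>k<n. P (xs ! k) (t ! k)) * [:N t ys:])
     - (\<Sum>t\<in>idx n. [:N xs t:] * (\<Prod>k<n. P (t ! k) (ys ! k)))"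
  have q: "poly q z = mat_mul (idx n) (tensor_mat n (\<lambda>r s. poly (P r s) z)) N xs ys
     - mat_mul (idx n) N (tensor_mat n (\<lambda>r s. poly (P r s) z)) xs ys" for z
    by (simp add: q_def mat_mul_def tensor_mat_def poly_sum poly_prod mult.commute)
  have "Z \<subseteq> {z. poly q z = 0}" using assms(2) xy by (auto simp: q commutes_def)
  then have "infinite {z. poly q z = 0}" using assms(1) finite_subset by blast
  then have "q = 0" using poly_roots_finite by blast
  then show "mat_mul (idx n) (tensor_mat n (\<lambda>r s. poly (P r s) z)) N xs ys
     = mat_mul (idx n) N (tensor_mat n (\<lambda>r s. poly (P r s) z)) xs ys" using q[of z] by simp
qed

lemma infinite_unit_circle: "infinite {z::complex. cmod z = 1}"
proof
  assume "finite {z::complex. cmod z = 1}"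
  then have "finite (Re ` {z::complex. cmod z = 1})" by simp
  moreover have "{-1..1} \<subseteq> Re ` {z::complex. cmod z = 1}"
  proof
    fix x :: real assume "x \<in> {-1..1}"
    then have "x\<^sup>2 \<le> 1" by (simp add: abs_square_le_1 abs_le_iff)
    then have "cmod (Complex x (sqrt (1 - x\<^sup>2))) = 1" by (simp add: cmod_def)
    then show "x \<in> Re ` {z::complex. cmod z = 1}" by (intro image_eqI[of _ _ "Complex x (sqrt (1 - x\<^sup>2))"]) auto
  qed
  ultimately have "finite {-1..1::real}" using finite_subset by blast
  then show False using infinite_Icc[of "-1" "1::real"] by simp
qed

text \<open>\<open>U\<close> multiplies the unit vector \<open>v\<close> by the phase
  \<open>z\<close> and fixes its orthogonal complement.\<close>

lemma unitary_phase_reflection: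
  fixes v :: "'r::finite \<Rightarrow> complex"
  assumes v: "(\<Sum>r\<in>UNIV. v r * cnj (v r)) = 1" and z: "cmod z = 1"
  defines "U \<equiv> \<lambda>r s. id_mat r s + (z - 1) * v r * cnj (v s)"
  shows "mat_mul UNIV (adj U) U = id_mat"
proof (intro ext)
  fix r s
  have zz: "z * cnj z = 1" using complex_norm_square[of z] z by simp
  have "mat_mul UNIV (adj U) U r s = (\<Sum>t\<in>UNIV. id_mat t r * id_mat t s
      + id_mat t r * ((z - 1) * v t * cnj (v s)) + id_mat t s * (cnj (z - 1) * cnj (v t) * v r)
      + (z - 1) * cnj (z - 1) * v r * cnj (v s) * (v t * cnj (v t)))"
    unfolding mat_mul_def by (intro sum.cong) (simp_all add: adj_def U_def id_mat_def algebra_simps)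
  also have "\<dots> = id_mat r s + (z - 1) * v r * cnj (v s) + cnj (z - 1) * cnj (v s) * v r
      + (z - 1) * cnj (z - 1) * v r * cnj (v s) * (\<Sum>t\<in>UNIV. v t * cnj (v t))"
    by (simp add: sum.distrib sum_distrib_left id_mat_def)
  also have "\<dots> = id_mat r s + (z * cnj z - 1) * v r * cnj (v s)"
    unfolding v by (simp add: algebra_simps)
  finally show "mat_mul UNIV (adj U) U r s = id_mat r s" using zz by simp
qed

section \<open>From unitary to arbitrary matrices\<close>

context
  fixes n :: nat and N :: "'r::finite list \<Rightarrow> 'r list \<Rightarrow> complex"
  assumes unitary_commutes: "\<And>U. mat_mul UNIV (adj U) U = id_mat \<Longrightarrow> commutes n N (tensor_mat n U)"
begin

text \<open>The phase reflections along the normalized \<open>v\<close> depend linearly on the phase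
  \<open>z\<close>, so commutation extends from the unit circle to all complex
  \<open>z\<close>.\<close>

lemma commutes_id_mat_plus_projection:
  "commutes n N (tensor_mat n (\<lambda>r s. id_mat r s + c * v r * cnj (v s)))"
proof (cases "\<forall>r. v r = 0")
  case True
  then have "(\<lambda>r s. id_mat r s + c * v r * cnj (v s)) = id_mat" by auto
  moreover have "mat_mul UNIV (adj id_mat) id_mat = (id_mat :: 'r \<Rightarrow> _)" by (auto simp: fun_eq_iff)
  ultimately show ?thesis using unitary_commutes by simp
next
  case False
  define s where "s = (\<Sum>r\<in>UNIV. (cmod (v r))\<^sup>2)"
  have s: "s > 0" unfolding s_def
    using False by (auto intro!: sum_pos2 simp: zero_less_power2)
  define u where "u = (\<lambda>r. v r / of_real (sqrt s))"
  have us: "u r * cnj (u r') = v r * cnj (v r') / of_real s" for r r'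
  proof -
    have "u r * cnj (u r') = v r * cnj (v r') / of_real (sqrt s * sqrt s)"
      by (simp add: u_def del: real_sqrt_mult_self)
    then show ?thesis using s by simp
  qed
  have u: "(\<Sum>r\<in>UNIV. u r * cnj (u r)) = 1"
  proof -
    have "(\<Sum>r\<in>UNIV. u r * cnj (u r)) = of_real s / of_real s"
      unfolding us sum_divide_distrib[symmetric] by (simp only: s_def of_real_sum complex_norm_square)
    then show ?thesis using s by simp
  qed
  let ?P = "\<lambda>r r'. [:id_mat r r' - u r * cnj (u r'), u r * cnj (u r'):]"
  have "commutes n N (tensor_mat n (\<lambda>r r'. poly (?P r r') z))" for z
  proof (rule commutes_tensor_mat_poly[OF infinite_unit_circle])
    fix z :: complex assume "z \<in> {z. cmod z = 1}"
    then have "commutes n N (tensor_mat n (\<lambda>r r'. id_mat r r' + (z - 1) * u r * cnj (u r')))"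
      by (intro unitary_commutes unitary_phase_reflection u) auto
    then show "commutes n N (tensor_mat n (\<lambda>r r'. poly (?P r r') z))" by (simp add: algebra_simps)
  qed
  note key = this
  \<comment> \<open>The parameter \<open>1 + c * s\<close> undoes the normalization of
    \<open>v\<close> and leaves the prefactor \<open>c\<close>.\<close>
  have "poly (?P r r') (1 + c * of_real s) = id_mat r r' + c * v r * cnj (v r')" for r r'
    using s by (simp add: us field_simps)
  then have "(\<lambda>r r'. poly (?P r r') (1 + c * of_real s)) = (\<lambda>r s. id_mat r s + c * v r * cnj (v s))"
    by (intro ext)
  from key[of "1 + c * of_real s", unfolded this] show ?thesis .
qed

text \<open>The vector \<open>v = p + \<i>yq\<close> gives a family that is polynomial in the real parameter \<open>y\<close>;
  at \<open>y = -\<i>\<close> the two factors \<open>v\<close> and \<open>v\<^sup>*\<close> become independent.\<close>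

lemma commutes_id_mat_plus_rank_one:
  "commutes n N (tensor_mat n (\<lambda>r s. id_mat r s + u r * w s))"
proof -
  \<comment> \<open>Chosen so that \<open>p + q\<close> is \<open>u\<close> and \<open>p - q\<close>
    is the conjugate of \<open>w\<close>.\<close>
  define p where "p = (\<lambda>r. (u r + cnj (w r)) / 2)"
  define q where "q = (\<lambda>r. (u r - cnj (w r)) / 2)"
  \<comment> \<open>Only coefficients are conjugated in the second factor: it is the conjugate of
    the first at real parameters, yet polynomial in the parameter everywhere.\<close>
  let ?P = "\<lambda>r s. [:id_mat r s:] + [:p r, \<i> * q r:] * [:cnj (p s), - \<i> * cnj (q s):]"
  have inf: "infinite (range complex_of_real)"
    by (simp add: finite_image_iff inj_on_def infinite_UNIV_char_0)
  have "commutes n N (tensor_mat n (\<lambda>r s. poly (?P r s) z))" for z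
  proof (rule commutes_tensor_mat_poly[OF inf])
    fix z assume "z \<in> range complex_of_real"
    then obtain y where y: "z = complex_of_real y" by auto
    have "(\<lambda>r s. poly (?P r s) z)
       = (\<lambda>r s. id_mat r s + 1 * (p r + \<i> * y * q r) * cnj (p s + \<i> * y * q s))"
      by (auto simp: fun_eq_iff y algebra_simps)
    then show "commutes n N (tensor_mat n (\<lambda>r s. poly (?P r s) z))"
      using commutes_id_mat_plus_projection[of 1 "\<lambda>r. p r + \<i> * y * q r"] by simp
  qed
  note key = this
  have "poly (?P r s) (- \<i>) = id_mat r s + u r * w s" for r s
  proof -
    have "poly (?P r s) (- \<i>) = id_mat r s + (p r + q r) * (cnj (p s) - cnj (q s))"
      by (simp add: algebra_simps)
    also have "p r + q r = u r" by (simp add: p_def q_def field_simps)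
    also have "cnj (p s) - cnj (q s) = w s" by (simp add: p_def q_def field_simps)
    finally show ?thesis .
  qed
  then have "(\<lambda>r s. poly (?P r s) (- \<i>)) = (\<lambda>r s. id_mat r s + u r * w s)"
    by (intro ext)
  from key[of "- \<i>", unfolded this] show ?thesis .
qed

end

text \<open>Diagonal dominance: in a kernel vector, the equation at the coordinate of greatest
  modulus forces that coordinate, hence all of them, to vanish. For square matrices injectivity
  gives a two-sided inverse.\<close>

lemma exists_right_inverse_large:
  fixes Y :: "'r::finite \<Rightarrow> 'r \<Rightarrow> complex"
  assumes "(\<Sum>r\<in>UNIV. \<Sum>s\<in>UNIV. cmod (Y r s)) < cmod t"
  shows "\<exists>Z. mat_mul UNIV (\<lambda>r s. t * id_mat r s + Y r s) Z = id_mat"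
proof -
  let ?A = "\<chi> r s. t * id_mat r s + Y r s"
  have "x = 0" if x: "?A *v x = 0" for x
  proof -
    obtain r where r: "\<And>s. cmod (x $ s) \<le> cmod (x $ r)"
    proof -
      have "finite (range (\<lambda>s. cmod (x $ s)))" by simp
      then have "Max (range (\<lambda>s. cmod (x $ s))) \<in> range (\<lambda>s. cmod (x $ s))" by (intro Max_in) auto
      then obtain r where "cmod (x $ r) = Max (range (\<lambda>s. cmod (x $ s)))" by (metis imageE)
      then show ?thesis using that[of r] by simp
    qed
    have "0 = (\<Sum>s\<in>UNIV. (t * id_mat r s + Y r s) * x $ s)"
      using arg_cong[OF x, of "\<lambda>v. v $ r"] by (simp add: matrix_vector_mult_def)
    also have "\<dots> = t * x $ r + (\<Sum>s\<in>UNIV. Y r s * x $ s)"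
      by (simp add: distrib_right sum.distrib id_mat_def mult.assoc flip: sum_distrib_left)
    finally have "t * x $ r = - (\<Sum>s\<in>UNIV. Y r s * x $ s)" by (simp add: eq_neg_iff_add_eq_0)
    then have "cmod t * cmod (x $ r) = cmod (\<Sum>s\<in>UNIV. Y r s * x $ s)"
      by (metis norm_minus_cancel norm_mult)
    also have "\<dots> \<le> (\<Sum>s\<in>UNIV. cmod (Y r s) * cmod (x $ s))"
      by (rule order_trans[OF norm_sum]) (simp add: norm_mult)
    also have "\<dots> \<le> (\<Sum>s\<in>UNIV. cmod (Y r s)) * cmod (x $ r)"
      unfolding sum_distrib_right by (intro sum_mono mult_left_mono r) auto
    also have "\<dots> \<le> (\<Sum>r\<in>UNIV. \<Sum>s\<in>UNIV. cmod (Y r s)) * cmod (x $ r)"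
      by (intro mult_right_mono member_le_sum[of r UNIV "\<lambda>r. \<Sum>s\<in>UNIV. cmod (Y r s)"]) (auto intro: sum_nonneg)
    finally have "cmod (x $ r) = 0" using assms
      by (metis linorder_not_less mult_le_cancel_right norm_ge_zero order_antisym_conv)
    then have "x $ s = 0" for s using r[of s] by simp
    then show "x = 0" by (simp add: vec_eq_iff)
  qed
  then obtain B where "B ** ?A = mat 1" using matrix_left_invertible_ker[of ?A] by blast
  then have B: "?A ** B = mat 1" by (simp add: matrix_left_right_inverse)
  have "mat_mul UNIV (\<lambda>r s. t * id_mat r s + Y r s) (\<lambda>r s. B $ r $ s) = id_mat"
  proof (intro ext)
    fix r s
    show "mat_mul UNIV (\<lambda>r s. t * id_mat r s + Y r s) (\<lambda>r s. B $ r $ s) r s = id_mat r s"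
      using arg_cong[OF B, of "\<lambda>v. v $ r $ s"]
      by (simp add: matrix_matrix_mult_def mat_mul_def mat_def id_mat_def)
  qed
  then show ?thesis by blast
qed

context
  fixes n :: nat and N :: "'r::finite list \<Rightarrow> 'r list \<Rightarrow> complex"
  assumes unitary_commutes: "\<And>U. mat_mul UNIV (adj U) U = id_mat \<Longrightarrow> commutes n N (tensor_mat n U)"
begin

text \<open>The entries of \<open>X\<close> are added one at a time to a multiple \<open>t\<close>
  of the identity. For large \<open>t\<close> the matrix so far is invertible, and adding an entry
  is multiplication by identity plus rank one; polynomial extension then reaches every
  \<open>t\<close>, in the end \<open>t = 0\<close>.\<close>

lemma commutes_tensor_mat: "commutes n N (tensor_mat n X)"
proof -
  let ?Y = "\<lambda>F r s. if (r, s) \<in> F then X r s else 0"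
  have "commutes n N (tensor_mat n (\<lambda>r s. t * id_mat r s + ?Y F r s))" for F t
  proof (induction F arbitrary: t rule: finite_induct[OF finite])
    case 1
    show ?case unfolding commutes_def
    proof (intro ballI)
      fix xs ys :: "'r list" assume xy: "xs \<in> idx n" "ys \<in> idx n"
      have *: "mat_mul (idx n) (tensor_mat n (\<lambda>r s. t * id_mat r s)) N xs ys
          = mat_mul (idx n) (\<lambda>xs ys. t ^ n * id_mat xs ys) N xs ys"
        "mat_mul (idx n) N (tensor_mat n (\<lambda>r s. t * id_mat r s)) xs ys
          = mat_mul (idx n) N (\<lambda>xs ys. t ^ n * id_mat xs ys) xs ys"
        by (rule mat_mul_cong; simp add: xy tensor_mat_scaled_id_mat)+
      have "mat_mul (idx n) (\<lambda>xs ys. t ^ n * id_mat xs ys) N xs ys = t ^ n * mat_mul (idx n) id_mat N xs ys"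
        "mat_mul (idx n) N (\<lambda>xs ys. t ^ n * id_mat xs ys) xs ys = t ^ n * mat_mul (idx n) N id_mat xs ys"
        by (auto simp: mat_mul_def sum_distrib_left mult_ac)
      then show "mat_mul (idx n) (tensor_mat n (\<lambda>r s. t * id_mat r s + ?Y {} r s)) N xs ys =
           mat_mul (idx n) N (tensor_mat n (\<lambda>r s. t * id_mat r s + ?Y {} r s)) xs ys"
        using * xy by simp
    qed
  next
    case (2 ab F)
    obtain a b where ab: "ab = (a, b)" by (cases ab)
    define T where "T = (\<Sum>r\<in>UNIV. \<Sum>s\<in>UNIV. cmod (?Y F r s))"
    let ?P = "\<lambda>r s. [:?Y (insert ab F) r s, id_mat r s:]"
    have inf: "infinite {t::complex. T < cmod t}"
    proof
      assume "finite {t::complex. T < cmod t}"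
      then have "finite (complex_of_real ` {max T 0<..})" by (rule finite_subset[rotated]) auto
      then have "finite {max T 0<..}" by (simp add: finite_image_iff inj_on_def)
      then show False using infinite_Ioi by blast
    qed
    have "commutes n N (tensor_mat n (\<lambda>r s. poly (?P r s) z))" for z
    proof (rule commutes_tensor_mat_poly[OF inf])
      fix t assume "t \<in> {t::complex. T < cmod t}"
      then obtain Z where Z: "mat_mul UNIV (\<lambda>r s. t * id_mat r s + ?Y F r s) Z = id_mat"
        using exists_right_inverse_large[of "?Y F" t] by (auto simp: T_def)
      \<comment> \<open>Since \<open>?A\<close> times \<open>Z\<close> is the identity, multiplying
        \<open>?A\<close> by \<open>?V\<close> adds exactly the entry \<open>X a b\<close> at
        position \<open>(a, b)\<close>.\<close>
      let ?V = "\<lambda>r s. id_mat r s + (X a b * Z r a) * id_mat b s"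
      let ?A = "\<lambda>r s. t * id_mat r s + ?Y F r s"
      have "mat_mul UNIV ?A ?V r s = t * id_mat r s + ?Y (insert ab F) r s" for r s
      proof -
        have "mat_mul UNIV ?A ?V r s = mat_mul UNIV ?A id_mat r s + X a b * id_mat b s * mat_mul UNIV ?A Z r a"
          unfolding mat_mul_def by (simp add: distrib_left sum.distrib sum_distrib_left mult_ac)
        also have "\<dots> = ?A r s + X a b * id_mat b s * id_mat r a"
          unfolding Z by simp
        finally show ?thesis using 2(2) by (auto simp: ab id_mat_def)
      qed
      moreover have "commutes n N (tensor_mat n (mat_mul UNIV ?A ?V))"
        by (intro commutes_tensor_mat_mat_mul 2 commutes_id_mat_plus_rank_one unitary_commutes)
      moreover have "(\<lambda>r s. poly (?P r s) t) = mat_mul UNIV ?A ?V"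
        using calculation(1) by (auto simp: fun_eq_iff)
      ultimately show "commutes n N (tensor_mat n (\<lambda>r s. poly (?P r s) t))" by simp
    qed
    from this[of t] show ?case by (simp add: add.commute)
  qed
  from this[of 0 UNIV] show ?thesis by simp
qed

end

section \<open>Schur--Weyl duality\<close>

text \<open>A surjection of a finite set onto itself is a bijection. The two kinds of functions
  differ only off \<open>{..<n}\<close>, where one is undefined and the other the identity, and
  \<open>h\<close> does not see those values.\<close>

lemma sum_surjective_functions_eq_sum_permutations:
  fixes h :: "(nat \<Rightarrow> nat) \<Rightarrow> complex"
  assumes "\<And>f. h (restrict f {..<n}) = h f"
  shows "(\<Sum>f | f \<in> {..<n} \<rightarrow>\<^sub>E {..<n} \<and> f ` {..<n} = {..<n}. h f) = (\<Sum>p | p permutes {..<n}. h p)"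
proof (rule sym, rule sum.reindex_bij_witness[of _ "\<lambda>f k. if k < n then f k else k" "\<lambda>p. restrict p {..<n}"])
  fix p assume p: "p \<in> {p. p permutes {..<n}}"
  then have p': "p permutes {..<n}" by simp
  show "(\<lambda>k. if k < n then restrict p {..<n} k else k) = p"
    using permutes_not_in[OF p'] by (auto simp: fun_eq_iff)
  show "restrict p {..<n} \<in> {f \<in> {..<n} \<rightarrow>\<^sub>E {..<n}. f ` {..<n} = {..<n}}"
    using permutes_image[OF p'] by auto
  show "h (restrict p {..<n}) = h p" by (rule assms)
next
  fix f assume f: "f \<in> {f \<in> {..<n} \<rightarrow>\<^sub>E {..<n}. f ` {..<n} = {..<n}}"
  show "restrict (\<lambda>k. if k < n then f k else k) {..<n} = f"
    using f by (auto simp: fun_eq_iff PiE_def extensional_def)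
  have "inj_on f {..<n}" using f by (intro eq_card_imp_inj_on) auto
  then have "bij_betw f {..<n} {..<n}" using f by (simp add: bij_betw_def)
  then have "bij_betw (\<lambda>k. if k < n then f k else k) {..<n} {..<n}"
    by (subst bij_betw_cong[of _ _ f]) auto
  then have "(\<lambda>k. if k < n then f k else k) permutes {..<n}"
    by (rule bij_imp_permutes) auto
  then show "(\<lambda>k. if k < n then f k else k) \<in> {p. p permutes {..<n}}" by simp
qed

text \<open>Inclusion-exclusion over images: the product of the sums over \<open>S\<close> expands
  into a sum over all functions into \<open>S\<close>, and Moebius inversion isolates those with
  image \<open>{..<n}\<close>. It turns a symmetrized product of different matrices into a
  combination of tensor powers.\<close>

lemma ryser_formula:
  fixes a :: "nat \<Rightarrow> nat \<Rightarrow> complex"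
  shows "(\<Sum>p | p permutes {..<n}. \<Prod>j<n. a (p j) j)
    = (\<Sum>S\<in>Pow {..<n}. (-1) ^ (n - card S) * (\<Prod>j<n. \<Sum>k\<in>S. a k j))"
proof -
  define f where "f = (\<lambda>R. \<Sum>h | h \<in> {..<n} \<rightarrow>\<^sub>E R \<and> h ` {..<n} = R. \<Prod>j<n. a (h j) j)"
  define gg where "gg = (\<lambda>S. \<Prod>j<n. \<Sum>k\<in>S. a k j)"
  have gf: "gg S = sum f (Pow S)" if S: "finite S" for S
  proof -
    have fin: "finite ({..<n} \<rightarrow>\<^sub>E S)" using S by (intro finite_PiE) auto
    have "gg S = (\<Sum>h\<in>{..<n} \<rightarrow>\<^sub>E S. \<Prod>j<n. a (h j) j)"
      unfolding gg_def using S by (subst prod_sum_PiE) auto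
    also have "\<dots> = (\<Sum>R\<in>Pow S. \<Sum>h | h \<in> {..<n} \<rightarrow>\<^sub>E S \<and> h ` {..<n} = R. \<Prod>j<n. a (h j) j)"
      by (rule sum.group[symmetric]) (use fin S in auto)
    also have "\<dots> = sum f (Pow S)"
      unfolding f_def
    proof (rule sum.cong[OF refl])
      fix R assume "R \<in> Pow S"
      then have "{h \<in> {..<n} \<rightarrow>\<^sub>E S. h ` {..<n} = R} = {h \<in> {..<n} \<rightarrow>\<^sub>E R. h ` {..<n} = R}"
        by (auto simp: PiE_def Pi_def)
      then show "(\<Sum>h | h \<in> {..<n} \<rightarrow>\<^sub>E S \<and> h ` {..<n} = R. \<Prod>j<n. a (h j) j)
        = (\<Sum>h | h \<in> {..<n} \<rightarrow>\<^sub>E R \<and> h ` {..<n} = R. \<Prod>j<n. a (h j) j)" by simp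
    qed
    finally show ?thesis .
  qed
  have "f {..<n} = (\<Sum>T\<in>Pow {..<n}. (-1) ^ (card {..<n} - card T) * gg T)"
    by (rule inclusion_exclusion_mobius[OF gf]) auto
  moreover have "f {..<n} = (\<Sum>p | p permutes {..<n}. \<Prod>j<n. a (p j) j)"
    unfolding f_def by (rule sum_surjective_functions_eq_sum_permutations) (auto intro!: prod.cong)
  ultimately show ?thesis by (simp add: gg_def)
qed

definition perm_list :: "(nat \<Rightarrow> nat) \<Rightarrow> nat \<Rightarrow> 'x list \<Rightarrow> 'x list" where
  "perm_list p n xs = map (\<lambda>k. xs ! p k) [0..<n]"

lemma perm_list_in_idx [simp]: "perm_list p n xs \<in> idx n"
  by (simp add: perm_list_def idx_def)

lemma nth_perm_list: "k < n \<Longrightarrow> perm_list p n xs ! k = xs ! p k"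
  by (simp add: perm_list_def)

lemma prod_id_mat_eq:
  assumes "u \<in> idx n" "\<And>k. k < n \<Longrightarrow> w ! k = x k" "w \<in> idx n"
  shows "(\<Prod>k<n. id_mat (u ! k) (x k)) = id_mat u w"
  using tensor_mat_id_mat[OF assms(1,3)] assms(2) by (simp add: tensor_mat_def)

lemma commutes_sum:
  fixes N :: "'r list \<Rightarrow> 'r list \<Rightarrow> complex"
  assumes "\<And>c. c \<in> C \<Longrightarrow> commutes n N (B c)"
    and "\<And>xs ys. xs \<in> idx n \<Longrightarrow> ys \<in> idx n \<Longrightarrow> A xs ys = (\<Sum>c\<in>C. \<alpha> c * B c xs ys)"
  shows "commutes n N A"
  unfolding commutes_def
proof (intro ballI)
  fix xs ys :: "'r list" assume xy: "xs \<in> idx n" "ys \<in> idx n"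
  have "mat_mul (idx n) A N xs ys = (\<Sum>t\<in>idx n. (\<Sum>c\<in>C. \<alpha> c * B c xs t) * N t ys)"
    unfolding mat_mul_def using assms(2) xy by (intro sum.cong) auto
  also have "\<dots> = (\<Sum>c\<in>C. \<alpha> c * mat_mul (idx n) (B c) N xs ys)"
    unfolding mat_mul_def sum_distrib_left sum_distrib_right mult.assoc by (rule sum.swap)
  also have "\<dots> = (\<Sum>c\<in>C. \<alpha> c * mat_mul (idx n) N (B c) xs ys)"
    using assms(1) xy by (intro sum.cong) (auto simp: commutes_def)
  also have "\<dots> = (\<Sum>c\<in>C. \<Sum>t\<in>idx n. N xs t * (\<alpha> c * B c t ys))"
    by (simp add: mat_mul_def sum_distrib_left mult_ac)
  also have "\<dots> = (\<Sum>t\<in>idx n. \<Sum>c\<in>C. N xs t * (\<alpha> c * B c t ys))" by (rule sum.swap)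
  also have "\<dots> = (\<Sum>t\<in>idx n. N xs t * (\<Sum>c\<in>C. \<alpha> c * B c t ys))"
    by (simp add: sum_distrib_left)
  also have "\<dots> = mat_mul (idx n) N A xs ys"
    unfolding mat_mul_def using assms(2) xy by (intro sum.cong) auto
  finally show "mat_mul (idx n) A N xs ys = mat_mul (idx n) N A xs ys" .
qed

text \<open>Permutation-invariant matrices are spanned by symmetrized products of matrix units, and
  these are combinations of tensor powers by Ryser's formula.\<close>

lemma commutes_symmetric:
  fixes N :: "'r::finite list \<Rightarrow> 'r list \<Rightarrow> complex"
  assumes N: "\<And>U. mat_mul UNIV (adj U) U = id_mat \<Longrightarrow> commutes n N (tensor_mat n U)"
    and B: "\<And>p xs ys. p permutes {..<n} \<Longrightarrow> xs \<in> idx n \<Longrightarrow> ys \<in> idx n \<Longrightarrow>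
       B (perm_list p n xs) (perm_list p n ys) = B xs ys"
  shows "commutes n N B"
proof -
  \<comment> \<open>\<open>E u v k\<close> is the matrix unit with row \<open>u ! k\<close> and
    column \<open>v ! k\<close>; \<open>T (u, v)\<close> distributes these \<open>n\<close> units
    over the \<open>n\<close> positions in all ways.\<close>
  define E where "E = (\<lambda>u v k (x::'r) (y::'r). id_mat (u ! k) x * id_mat (v ! k) y)"
  define T where "T = (\<lambda>uv xs ys. \<Sum>p | p permutes {..<n}.
      \<Prod>j<n. E (fst uv) (snd uv) (p j) (xs ! j) (ys ! j))"
  have T: "commutes n N (T uv)" for uv
  proof (rule commutes_sum)
    show "commutes n N (tensor_mat n (\<lambda>x y. \<Sum>k\<in>S. E (fst uv) (snd uv) k x y))" for S
      by (rule commutes_tensor_mat[OF N])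
    show "T uv xs ys = (\<Sum>S\<in>Pow {..<n}. (-1) ^ (n - card S) *
        tensor_mat n (\<lambda>x y. \<Sum>k\<in>S. E (fst uv) (snd uv) k x y) xs ys)" for xs ys
      unfolding T_def tensor_mat_def by (rule ryser_formula)
  qed
  show ?thesis
  proof (rule commutes_sum[OF T])
    fix xs ys :: "'r list" assume xy: "xs \<in> idx n" "ys \<in> idx n"
    have Ep: "(\<Prod>j<n. E u v (p j) (xs ! j) (ys ! j))
        = id_mat u (perm_list (inv p) n xs) * id_mat v (perm_list (inv p) n ys)"
      if p: "p permutes {..<n}" and uv: "u \<in> idx n" "v \<in> idx n" for u v p
    proof -
      have "(\<Prod>j<n. E u v (p j) (xs ! j) (ys ! j)) = (\<Prod>k<n. E u v k (xs ! inv p k) (ys ! inv p k))"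
        by (rule prod.reindex_bij_witness[of _ "inv p" p])
           (use permutes_inverses[OF p] permutes_in_image[OF p]
             permutes_in_image[OF permutes_inv[OF p]] in auto)
      also have "\<dots> = (\<Prod>k<n. id_mat (u ! k) (xs ! inv p k)) * (\<Prod>k<n. id_mat (v ! k) (ys ! inv p k))"
        by (simp add: E_def prod.distrib)
      also have "(\<Prod>k<n. id_mat (u ! k) (xs ! inv p k)) = id_mat u (perm_list (inv p) n xs)"
        by (rule prod_id_mat_eq) (auto simp: uv nth_perm_list)
      also have "(\<Prod>k<n. id_mat (v ! k) (ys ! inv p k)) = id_mat v (perm_list (inv p) n ys)"
        by (rule prod_id_mat_eq) (auto simp: uv nth_perm_list)
      finally show ?thesis .
    qed
    let ?I = "idx n :: 'r list set"
    \<comment> \<open>The entries of \<open>B\<close> are the coefficients. Each permutation selects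
      one pair \<open>(u, v)\<close> and by invariance contributes the same value, whence the factor
      \<open>1 / fact n\<close>.\<close>
    have "(\<Sum>uv\<in>?I \<times> ?I. B (fst uv) (snd uv) / fact n * T uv xs ys)
       = (\<Sum>uv\<in>?I \<times> ?I. \<Sum>p | p permutes {..<n}. B (fst uv) (snd uv) / fact n *
           (id_mat (fst uv) (perm_list (inv p) n xs) * id_mat (snd uv) (perm_list (inv p) n ys)))"
      unfolding T_def sum_distrib_left by (intro sum.cong) (auto simp: Ep)
    also have "\<dots> = (\<Sum>p | p permutes {..<n}. \<Sum>uv\<in>?I \<times> ?I. B (fst uv) (snd uv) / fact n *
           (id_mat (fst uv) (perm_list (inv p) n xs) * id_mat (snd uv) (perm_list (inv p) n ys)))"
      by (rule sum.swap)
    also have "\<dots> = (\<Sum>p | p permutes {..<n}. B xs ys / fact n)"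
    proof (rule sum.cong[OF refl])
      fix p assume "p \<in> {p. p permutes {..<n}}"
      then have p: "inv p permutes {..<n}" by (simp add: permutes_inv)
      let ?x = "perm_list (inv p) n xs" and ?y = "perm_list (inv p) n ys"
      have "(\<Sum>uv\<in>?I \<times> ?I. B (fst uv) (snd uv) / fact n * (id_mat (fst uv) ?x * id_mat (snd uv) ?y))
          = (\<Sum>uv\<in>?I \<times> ?I. if uv = (?x, ?y) then B ?x ?y / fact n else 0)"
        by (intro sum.cong) (auto simp: id_mat_def)
      also have "\<dots> = B ?x ?y / fact n" by simp
      also have "\<dots> = B xs ys / fact n" using B[OF p xy] by simp
      finally show "(\<Sum>uv\<in>?I \<times> ?I. B (fst uv) (snd uv) / fact n * (id_mat (fst uv) ?x * id_mat (snd uv) ?y))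
          = B xs ys / fact n" .
    qed
    also have "\<dots> = B xs ys"
      using card_permutations[of "{..<n}" n] by simp
    finally show "B xs ys = (\<Sum>uv\<in>?I \<times> ?I. B (fst uv) (snd uv) / fact n * T uv xs ys)" by simp
  qed
qed

section \<open>Mixtures of symmetric rank-one operators\<close>

definition inner_idx :: "nat \<Rightarrow> ('i list \<Rightarrow> complex) \<Rightarrow> ('i list \<Rightarrow> complex) \<Rightarrow> complex" where
  "inner_idx n x y = (\<Sum>i\<in>idx n. cnj (x i) * y i)"

definition mixture :: "nat \<Rightarrow> (nat \<Rightarrow> real) \<Rightarrow> (nat \<Rightarrow> 'i \<Rightarrow> complex) \<Rightarrow> 'i \<Rightarrow> 'i \<Rightarrow> complex" where
  "mixture m w y i j = (\<Sum>k<m. of_real (w k) * (y k i * cnj (y k j)))"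

lemma sesq_form_mixture:
  "sesq_form (idx n) (mixture m w y) x z = (\<Sum>k<m. of_real (w k) * (inner_idx n x (y k) * cnj (inner_idx n z (y k))))"
proof -
  have "sesq_form (idx n) (mixture m w y) x z
      = (\<Sum>i\<in>idx n. \<Sum>j\<in>idx n. \<Sum>k<m. of_real (w k) * ((cnj (x i) * y k i) * (z j * cnj (y k j))))"
    by (simp add: sesq_form_def mixture_def sum_distrib_left sum_distrib_right mult_ac)
  also have "\<dots> = (\<Sum>i\<in>idx n. \<Sum>k<m. \<Sum>j\<in>idx n. of_real (w k) * ((cnj (x i) * y k i) * (z j * cnj (y k j))))"
    by (intro sum.cong[OF refl] sum.swap)
  also have "\<dots> = (\<Sum>k<m. \<Sum>i\<in>idx n. \<Sum>j\<in>idx n. of_real (w k) * ((cnj (x i) * y k i) * (z j * cnj (y k j))))"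
    by (rule sum.swap)
  also have "\<dots> = (\<Sum>k<m. of_real (w k) * (inner_idx n x (y k) * cnj (inner_idx n z (y k))))"
    by (simp add: inner_idx_def sum_product sum_distrib_left mult_ac)
  finally show ?thesis .
qed

lemma sesq_form_mixture_self:
  "sesq_form (idx n) (mixture m w y) x x = of_real (\<Sum>k<m. w k * (cmod (inner_idx n x (y k)))\<^sup>2)"
  by (simp add: sesq_form_mixture complex_norm_square[symmetric] del: of_real_power)

lemma psd_mixture:
  assumes "\<And>k. k < m \<Longrightarrow> 0 \<le> w k"
  shows "psd_on (idx n) (mixture m w y)"
  unfolding psd_on_def
proof
  fix v
  have "0 \<le> (\<Sum>k<m. w k * (cmod (inner_idx n v (y k)))\<^sup>2)" using assms by (intro sum_nonneg) auto
  then have "0 \<le> sesq_form (idx n) (mixture m w y) v v"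
    by (simp only: sesq_form_mixture_self less_eq_complex_def) simp
  then show "0 \<le> (\<Sum>i\<in>idx n. \<Sum>j\<in>idx n. cnj (v i) * mixture m w y i j * v j)"
    by (simp only: sesq_form_def)
qed

section \<open>The rank of a mixture of symmetric vectors\<close>

lemma in_sym_mset:
  assumes "in_sym n y" "xs \<in> idx n" "ys \<in> idx n" "mset xs = mset ys"
  shows "y xs = y ys"
proof -
  obtain p where p: "p permutes {..<length ys}" "permute_list p ys = xs"
    using mset_eq_permutation[OF assms(4)] by blast
  then have "xs = map (\<lambda>k. ys ! p k) [0..<n]" using assms(3) by (auto simp: permute_list_def idx_def)
  then show ?thesis using assms p(1) by (auto simp: in_sym_def idx_def)
qed

text \<open>Multisets of size \<open>n\<close> label a basis of the symmetric subspace; only this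
  count represents its dimension in what follows.\<close>

lemma g_eq_card_multisets: "g n CARD('i::finite) = card (multisets_of_size (UNIV :: 'i set) n)"
  by (simp add: g_def card_multisets_of_size add.commute)

text \<open>A symmetric vector is constant on the lists with a given multiset, so its inner product
  with \<open>z\<close> involves only the class sums of \<open>z\<close>.\<close>

lemma inner_idx_sym_eq_0:
  fixes z :: "'i::finite list \<Rightarrow> complex"
  assumes y: "in_sym n y"
    and z: "\<And>\<mu>. \<mu> \<in> multisets_of_size UNIV n \<Longrightarrow> (\<Sum>xs | xs \<in> idx n \<and> mset xs = \<mu>. z xs) = 0"
  shows "inner_idx n z y = 0"
proof -
  let ?S = "multisets_of_size (UNIV :: 'i set) n"
  have fin: "finite ?S" by (intro finite_multisets_of_size) simp
  have "inner_idx n z y = (\<Sum>\<mu>\<in>?S. \<Sum>xs | xs \<in> idx n \<and> mset xs = \<mu>. cnj (z xs) * y xs)"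
    unfolding inner_idx_def by (rule sum.group[symmetric]) (use fin in \<open>auto simp: multisets_of_size_def idx_def[THEN eqset_imp_iff]\<close>)
  also have "\<dots> = 0"
  proof (rule sum.neutral, rule ballI)
    fix \<mu> assume mu: "\<mu> \<in> ?S"
    show "(\<Sum>xs | xs \<in> idx n \<and> mset xs = \<mu>. cnj (z xs) * y xs) = 0"
    proof (cases "\<exists>ys. ys \<in> idx n \<and> mset ys = \<mu>")
      case True
      then obtain ys where ys: "ys \<in> idx n" "mset ys = \<mu>" by auto
      have "(\<Sum>xs | xs \<in> idx n \<and> mset xs = \<mu>. cnj (z xs) * y xs)
          = (\<Sum>xs | xs \<in> idx n \<and> mset xs = \<mu>. cnj (z xs) * y ys)"
        by (intro sum.cong refl arg_cong2[where f = "(*)"] in_sym_mset[OF y]) (use ys in auto)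
      also have "\<dots> = cnj (\<Sum>xs | xs \<in> idx n \<and> mset xs = \<mu>. z xs) * y ys"
        by (simp add: sum_distrib_right)
      finally show ?thesis using z[OF mu] by simp
    next
      case False
      then have "{xs. xs \<in> idx n \<and> mset xs = \<mu>} = {}" by blast
      then show ?thesis by (simp only: sum.empty)
    qed
  qed
  finally show ?thesis .
qed

text \<open>With more members than multisets, some nontrivial combination \<open>z\<close> of them
  has vanishing class sums. It is orthogonal to every atom, hence null for the mixture, whereas
  pairing it with \<open>e l\<close> returns its coefficient \<open>t l\<close>.\<close>

lemma orthonormal_system_le_g:
  fixes y :: "nat \<Rightarrow> 'i::finite list \<Rightarrow> complex"
  assumes y: "\<And>k. k < m \<Longrightarrow> in_sym n (y k)"
    and e: "orthonormal (idx n) (mixture m w y) r e"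
  shows "r \<le> g n CARD('i)"
proof (rule ccontr)
  assume "\<not> r \<le> g n CARD('i)"
  let ?S = "multisets_of_size (UNIV :: 'i set) n"
  define a where "a = (\<lambda>\<mu> k. \<Sum>xs | xs \<in> idx n \<and> mset xs = \<mu>. e k xs)"
  have fin: "finite ?S" by (intro finite_multisets_of_size) simp
  have "card ?S < card {..<r}" using \<open>\<not> r \<le> g n CARD('i)\<close> by (simp add: g_eq_card_multisets)
  from exists_nontrivial_solution[OF fin _ this, of a] obtain t l where
    t: "l < r" "t l \<noteq> 0" "\<forall>\<mu>\<in>?S. (\<Sum>k<r. a \<mu> k * t k) = 0" by auto
  define z where "z = (\<lambda>xs. \<Sum>k<r. t k * e k xs)"
  have "(\<Sum>xs | xs \<in> idx n \<and> mset xs = \<mu>. z xs) = 0" if "\<mu> \<in> ?S" for \<mu>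
  proof -
    have "(\<Sum>xs | xs \<in> idx n \<and> mset xs = \<mu>. z xs) = (\<Sum>k<r. a \<mu> k * t k)"
      unfolding z_def a_def sum_distrib_right by (subst sum.swap) (simp add: mult.commute)
    then show ?thesis using t(3) that by simp
  qed
  then have "inner_idx n z (y k) = 0" if "k < m" for k using inner_idx_sym_eq_0[OF y[OF that]] by blast
  then have "sesq_form (idx n) (mixture m w y) (e l) z = 0" by (simp add: sesq_form_mixture)
  moreover have "sesq_form (idx n) (mixture m w y) (e l) z
      = (\<Sum>k<r. t k * sesq_form (idx n) (mixture m w y) (e l) (e k))"
    unfolding z_def by (rule sesq_form_sum_right) simp
  moreover have "\<dots> = (\<Sum>k<r. if k = l then t k else 0)"
    using e t(1) by (intro sum.cong) (auto simp: orthonormal_def)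
  ultimately show False using t(1,2) by simp
qed

text \<open>Here \<open>h k\<close> is the leverage of the atom \<open>y k\<close>, its squared
  length in coordinates orthonormal for the mixture. Exchanging sums shows that the weighted average
  of \<open>h\<close> is the rank \<open>r\<close>, so some atom lies at or below it.\<close>

lemma exists_low_leverage_atom:
  fixes y :: "nat \<Rightarrow> 'i::finite list \<Rightarrow> complex"
  assumes y: "\<And>k. k < m \<Longrightarrow> in_sym n (y k)"
    and w: "\<And>k. k < m \<Longrightarrow> 0 \<le> w k" "(\<Sum>k<m. w k) = 1"
  shows "\<exists>k<m. \<forall>x. (cmod (inner_idx n x (y k)))\<^sup>2
           \<le> real (g n CARD('i)) * Re (sesq_form (idx n) (mixture m w y) x x)"
proof -
  let ?B = "sesq_form (idx n) (mixture m w y)"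
  have psd: "psd_on (idx n) (mixture m w y)" using w by (intro psd_mixture)
  have bd: "m' \<le> g n CARD('i)" if "orthonormal (idx n) (mixture m w y) m' e" for m' e
    using orthonormal_system_le_g[of m n y w m' e] y that by blast
  obtain r e where r: "r \<le> g n CARD('i)" and e: "orthonormal (idx n) (mixture m w y) r e"
    and res: "\<And>x z. ?B z (\<lambda>i. x i - (\<Sum>k<r. ?B (e k) x * e k i)) = 0"
    by (rule psd_maximal_orthonormal_system[OF psd bd]) (assumption, rule that, assumption+)
  define h where "h = (\<lambda>k. \<Sum>a<r. (cmod (inner_idx n (e a) (y k)))\<^sup>2)"
  have "(\<Sum>k<m. w k * h k) = (\<Sum>k<m. \<Sum>a<r. w k * (cmod (inner_idx n (e a) (y k)))\<^sup>2)"
    by (simp add: h_def sum_distrib_left)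
  also have "\<dots> = (\<Sum>a<r. \<Sum>k<m. w k * (cmod (inner_idx n (e a) (y k)))\<^sup>2)" by (rule sum.swap)
  also have "\<dots> = (\<Sum>a<r. 1)"
  proof (rule sum.cong[OF refl])
    fix a assume "a \<in> {..<r}"
    then have "?B (e a) (e a) = 1" using e by (auto simp: orthonormal_def)
    then show "(\<Sum>k<m. w k * (cmod (inner_idx n (e a) (y k)))\<^sup>2) = 1"
      unfolding sesq_form_mixture_self using of_real_eq_1_iff by blast
  qed
  finally have tot: "(\<Sum>k<m. w k * h k) = real r" by simp
  \<comment> \<open>Positive weight is demanded as well, because a null vector of the mixture is
    guaranteed to be orthogonal only to atoms of positive weight.\<close>
  have "\<exists>k<m. w k > 0 \<and> h k \<le> real r"
  proof (rule ccontr)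
    assume "\<not> ?thesis"
    then have *: "h k > real r" if "k < m" "w k > 0" for k using that by force
    have le: "w k * real r \<le> w k * h k" if "k < m" for k
      using w(1)[OF that] *[OF that] by (cases "w k = 0") (auto intro!: mult_left_mono)
    obtain k0 where k0: "k0 < m" "w k0 > 0"
    proof -
      have "\<exists>k<m. w k \<noteq> 0" using w(2) by (metis lessThan_iff sum.neutral zero_neq_one)
      then show ?thesis using that w(1) by force
    qed
    have "(\<Sum>k<m. w k * real r) < (\<Sum>k<m. w k * h k)"
      using le k0 *[OF k0] by (intro sum_strict_mono_ex1 bexI[of _ k0]) auto
    moreover have "(\<Sum>k<m. w k * real r) = real r" using w(2) by (simp flip: sum_distrib_right)
    ultimately show False using tot by simp
  qed
  then obtain k where k: "k < m" "w k > 0" "h k \<le> real r" by auto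
  have "(cmod (inner_idx n x (y k)))\<^sup>2 \<le> real (g n CARD('i)) * Re (?B x x)" for x
  proof -
    \<comment> \<open>Up to the null vector \<open>z\<close>, which is orthogonal to
      \<open>y k\<close>, the vector \<open>x\<close> is a combination of the \<open>e a\<close>.
      Parseval and Cauchy-Schwarz in the coordinates \<open>c\<close> then give the bound.\<close>
    define c where "c = (\<lambda>a. ?B (e a) x)"
    define z where "z = (\<lambda>i. x i - (\<Sum>a<r. c a * e a i))"
    have z0: "?B u z = 0" for u unfolding z_def c_def by (rule res)
    have "(\<Sum>l<m. w l * (cmod (inner_idx n z (y l)))\<^sup>2) = 0"
      using z0[of z] unfolding sesq_form_mixture_self by (simp only: of_real_eq_0_iff)
    then have "w k * (cmod (inner_idx n z (y k)))\<^sup>2 = 0"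
      using w(1) k(1) by (subst (asm) sum_nonneg_eq_0_iff) auto
    then have "inner_idx n z (y k) = 0" using k(2) by simp
    moreover have "inner_idx n z (y k) = inner_idx n x (y k) - (\<Sum>a<r. cnj (c a) * inner_idx n (e a) (y k))"
    proof -
      have "inner_idx n z (y k) = inner_idx n x (y k) - (\<Sum>i\<in>idx n. \<Sum>a<r. cnj (c a) * (cnj (e a i) * y k i))"
        by (simp add: inner_idx_def z_def left_diff_distrib sum_subtractf sum_distrib_right mult.assoc)
      also have "(\<Sum>i\<in>idx n. \<Sum>a<r. cnj (c a) * (cnj (e a i) * y k i))
          = (\<Sum>a<r. \<Sum>i\<in>idx n. cnj (c a) * (cnj (e a i) * y k i))" by (rule sum.swap)
      finally show ?thesis by (simp add: inner_idx_def sum_distrib_left)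
    qed
    ultimately have eq: "inner_idx n x (y k) = (\<Sum>a<r. cnj (c a) * inner_idx n (e a) (y k))" by simp
    have xx: "Re (?B x x) = (\<Sum>a<r. (cmod (c a))\<^sup>2)"
    proof -
      have "0 = ?B x x - (\<Sum>a<r. c a * ?B x (e a))"
        using z0[of x] unfolding z_def by (simp add: sesq_form_diff_right sesq_form_sum_right)
      also have "(\<Sum>a<r. c a * ?B x (e a)) = (\<Sum>a<r. of_real ((cmod (c a))\<^sup>2))"
        by (intro sum.cong refl) (simp only: c_def psd_sesq_form_herm[OF psd, of x "e _"] complex_norm_square)
      finally show ?thesis by (simp flip: of_real_sum)
    qed
    have "cmod (inner_idx n x (y k)) \<le> (\<Sum>a<r. cmod (c a) * cmod (inner_idx n (e a) (y k)))"
      unfolding eq by (rule order_trans[OF norm_sum]) (simp add: norm_mult)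
    then have "(cmod (inner_idx n x (y k)))\<^sup>2 \<le> (\<Sum>a<r. cmod (c a) * cmod (inner_idx n (e a) (y k)))\<^sup>2"
      by (rule power_mono) simp
    also have "\<dots> \<le> Re (?B x x) * h k"
      unfolding xx h_def by (rule Cauchy_Schwarz_ineq_sum)
    also have "\<dots> \<le> Re (?B x x) * real (g n CARD('i))"
      using k(3) r by (intro mult_left_mono) (auto simp: xx intro!: sum_nonneg)
    finally show ?thesis by (simp add: mult.commute)
  qed
  then show ?thesis using k(1) by blast
qed

definition tensor_vec :: "nat \<Rightarrow> complex ^ 'i \<Rightarrow> 'i list \<Rightarrow> complex" where
  "tensor_vec n \<phi> xs = (\<Prod>k<n. \<phi> $ (xs ! k))"

lemma tpow_outer1: "tpow n (outer1 \<phi>) i j = tensor_vec n \<phi> i * cnj (tensor_vec n \<phi> j)"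
  by (simp add: tpow_def outer1_def tensor_vec_def prod.distrib)

lemma in_sym_tensor_vec: "in_sym n (tensor_vec n \<phi>)"
  unfolding in_sym_def
proof (intro ballI allI impI)
  fix xs :: "'a list" and p assume p: "p permutes {..<n}"
  have "tensor_vec n \<phi> (map (\<lambda>k. xs ! p k) [0..<n]) = (\<Prod>k<n. \<phi> $ (xs ! p k))" by (simp add: tensor_vec_def)
  also have "\<dots> = (\<Prod>k<n. \<phi> $ (xs ! k))" using prod.permute[OF p, of "\<lambda>k. \<phi> $ (xs ! k)"] by (simp add: o_def)
  finally show "tensor_vec n \<phi> (map (\<lambda>k. xs ! p k) [0..<n]) = tensor_vec n \<phi> xs" by (simp add: tensor_vec_def)
qed

section \<open>Mixtures of minimal Frobenius norm\<close>

text \<open>Linear in the first argument, in contrast to \<open>inner_idx\<close>.\<close>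

definition herm_prod :: "complex ^ 'i::finite \<Rightarrow> complex ^ 'i \<Rightarrow> complex" where
  "herm_prod \<phi> \<eta> = (\<Sum>x\<in>UNIV. \<phi> $ x * cnj (\<eta> $ x))"

definition frobenius_sq :: "nat \<Rightarrow> ('i list \<Rightarrow> 'i list \<Rightarrow> complex) \<Rightarrow> real" where
  "frobenius_sq n A = (\<Sum>i\<in>idx n. \<Sum>j\<in>idx n. (cmod (A i j))\<^sup>2)"

lemma sum_tensor_vec_cnj_tensor_vec: "(\<Sum>i\<in>idx n. tensor_vec n \<phi> i * cnj (tensor_vec n \<eta> i)) = herm_prod \<phi> \<eta> ^ n"
  using sum_idx_prod[of "\<lambda>_ x. \<phi> $ x * cnj (\<eta> $ x)" n]
  by (simp add: tensor_vec_def herm_prod_def prod.distrib)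

text \<open>The right-hand side depends on the atoms only through their pairwise products, so a map
  that preserves \<open>herm_prod\<close> preserves the norm of the mixture.\<close>

lemma frobenius_sq_mixture:
  "complex_of_real (frobenius_sq n (mixture m w (\<lambda>k. tensor_vec n (f k))))
    = (\<Sum>k<m. \<Sum>l<m. of_real (w k * w l) * (herm_prod (f k) (f l) ^ n * cnj (herm_prod (f k) (f l) ^ n)))"
proof -
  let ?t = "\<lambda>k. tensor_vec n (f k)"
  have "complex_of_real (frobenius_sq n (mixture m w ?t))
      = (\<Sum>i\<in>idx n. \<Sum>j\<in>idx n. mixture m w ?t i j * cnj (mixture m w ?t i j))"
    by (simp only: frobenius_sq_def of_real_sum complex_norm_square)
  also have "\<dots> = (\<Sum>i\<in>idx n. \<Sum>j\<in>idx n. \<Sum>k<m. \<Sum>l<m.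
       of_real (w k * w l) * ((?t k i * cnj (?t l i)) * cnj (?t k j * cnj (?t l j))))"
    by (simp add: mixture_def sum_product mult_ac)
  also have "\<dots> = (\<Sum>i\<in>idx n. \<Sum>k<m. \<Sum>j\<in>idx n. \<Sum>l<m.
       of_real (w k * w l) * ((?t k i * cnj (?t l i)) * cnj (?t k j * cnj (?t l j))))"
    by (intro sum.cong[OF refl] sum.swap)
  also have "\<dots> = (\<Sum>k<m. \<Sum>i\<in>idx n. \<Sum>j\<in>idx n. \<Sum>l<m.
       of_real (w k * w l) * ((?t k i * cnj (?t l i)) * cnj (?t k j * cnj (?t l j))))"
    by (rule sum.swap)
  also have "\<dots> = (\<Sum>k<m. \<Sum>i\<in>idx n. \<Sum>l<m. \<Sum>j\<in>idx n.
       of_real (w k * w l) * ((?t k i * cnj (?t l i)) * cnj (?t k j * cnj (?t l j))))"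
    by (intro sum.cong[OF refl] sum.swap)
  also have "\<dots> = (\<Sum>k<m. \<Sum>l<m. \<Sum>i\<in>idx n. \<Sum>j\<in>idx n.
       of_real (w k * w l) * ((?t k i * cnj (?t l i)) * cnj (?t k j * cnj (?t l j))))"
    by (intro sum.cong[OF refl] sum.swap)
  also have "\<dots> = (\<Sum>k<m. \<Sum>l<m. of_real (w k * w l) *
       ((\<Sum>i\<in>idx n. ?t k i * cnj (?t l i)) * cnj (\<Sum>j\<in>idx n. ?t k j * cnj (?t l j))))"
    by (simp only: sum_product cnj_sum) (simp only: sum_distrib_left)
  finally show ?thesis by (simp only: sum_tensor_vec_cnj_tensor_vec)
qed

text \<open>Strict convexity in quantitative form: the midpoint of two distinct matrices of equal
  norm has smaller norm.\<close>

lemma frobenius_sq_parallelogram: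
  "frobenius_sq n (\<lambda>i j. (A i j + B i j) / 2) = (frobenius_sq n A + frobenius_sq n B) / 2 - frobenius_sq n (\<lambda>i j. A i j - B i j) / 4"
proof -
  have "(cmod ((a + b) / 2))\<^sup>2 = ((cmod a)\<^sup>2 + (cmod b)\<^sup>2) / 2 - (cmod (a - b))\<^sup>2 / 4" for a b
    unfolding cmod_power2 by (simp add: power2_eq_square field_simps)
  then show ?thesis
    by (simp add: frobenius_sq_def sum.distrib sum_subtractf add_divide_distrib flip: sum_divide_distrib)
qed

lemma frobenius_sq_nonneg: "0 \<le> frobenius_sq n A"
  unfolding frobenius_sq_def by (intro sum_nonneg) auto

lemma frobenius_sq_eq_0:
  assumes "frobenius_sq n A \<le> 0" "i \<in> idx n" "j \<in> idx n"
  shows "A (i :: 'i::finite list) j = 0"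
proof -
  have "frobenius_sq n A = 0" using assms(1) frobenius_sq_nonneg by (intro antisym)
  then have "\<forall>i\<in>idx n. (\<Sum>j\<in>idx n. (cmod (A i j))\<^sup>2) = 0"
    unfolding frobenius_sq_def by (subst (asm) sum_nonneg_eq_0_iff) (auto intro: sum_nonneg)
  then have "(\<Sum>j\<in>idx n. (cmod (A i j))\<^sup>2) = 0" using assms by blast
  then show ?thesis using assms by (subst (asm) sum_nonneg_eq_0_iff) auto
qed

text \<open>The bound \<open>N\<close> counts real coordinates: the real and imaginary parts of all
  entries, plus one for the total weight. A length independent of \<open>S\<close> is what makes a
  compactness argument possible.\<close>

lemma mixture_tensor_vec_caratheodory:
  fixes K :: "(complex ^ 'i::finite) set" and S :: "nat set"
  assumes "finite S" "\<forall>k\<in>S. 0 \<le> w k" "\<forall>k\<in>S. f k \<in> K" "(\<Sum>k\<in>S. w k) = 1" "K \<noteq> {}"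
    and N: "N = 2 * CARD('i)^n * CARD('i)^n + 1"
  obtains v h where "\<forall>k. 0 \<le> v k" "\<forall>k. h k \<in> K" "(\<Sum>k<N. v k) = 1"
    "\<forall>i\<in>idx n. \<forall>j\<in>idx n. mixture N v (\<lambda>k. tensor_vec n (h k)) i j
       = (\<Sum>k\<in>S. of_real (w k) * (tensor_vec n (f k) i * cnj (tensor_vec n (f k) j)))"
proof -
  let ?I = "idx n :: 'i list set"
  define F where "F = (\<lambda>k i j. tensor_vec n (f k) i * cnj (tensor_vec n (f k) j))"
  \<comment> \<open>The coordinate \<open>None\<close> is constantly 1 and records the total weight;
    the Boolean chooses between real and imaginary part.\<close>
  define E where "E = insert None (Some ` ((?I \<times> ?I) \<times> (UNIV :: bool set)))"
  define a :: "(('i list \<times> 'i list) \<times> bool) option \<Rightarrow> nat \<Rightarrow> real" where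
    "a = (\<lambda>e k. case e of None \<Rightarrow> 1 | Some ((i, j), b) \<Rightarrow> if b then Re (F k i j) else Im (F k i j))"
  have E: "finite E" "card E = N"
    by (auto simp: N E_def card_insert_if card_image card_cartesian_product card_idx)
  obtain T u where T: "T \<subseteq> S" "card T \<le> N" "\<forall>k\<in>T. 0 \<le> u k"
    and eq: "\<forall>e\<in>E. (\<Sum>k\<in>T. u k * a e k) = (\<Sum>k\<in>S. w k * a e k)"
    using conic_caratheodory[OF E(1) assms(1), of w a] assms(2) unfolding E(2) by auto
  have finT: "finite T" using T(1) assms(1) finite_subset by blast
  obtain b where b: "bij_betw b {..<card T} T"
    using ex_bij_betw_nat_finite[OF finT] by (auto simp: atLeast0LessThan)
  have bT: "b k \<in> T" if "k < card T" for k using b that by (auto simp: bij_betw_def)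
  obtain \<phi>0 where \<phi>0: "\<phi>0 \<in> K" using assms(5) by auto
  \<comment> \<open>Padding with zero weights and a fixed point of \<open>K\<close> brings every
    mixture to the length \<open>N\<close> exactly.\<close>
  define v where "v = (\<lambda>k. if k < card T then u (b k) else 0)"
  define h where "h = (\<lambda>k. if k < card T then f (b k) else \<phi>0)"
  have sum_eq: "(\<Sum>k<N. if k < card T then G (b k) else 0) = (\<Sum>k\<in>T. G k)"
    for G :: "nat \<Rightarrow> 'z::comm_monoid_add"
  proof -
    have "(\<Sum>k<N. if k < card T then G (b k) else 0) = (\<Sum>k<card T. G (b k))"
      using T(2) by (intro sum.mono_neutral_cong_right) auto
    also have "\<dots> = (\<Sum>k\<in>T. G k)" by (rule sum.reindex_bij_betw[OF b])
    finally show ?thesis .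
  qed
  have "(\<Sum>k<N. v k) = (\<Sum>k\<in>T. u k)" unfolding v_def by (rule sum_eq)
  also have "\<dots> = 1" using eq assms(4) by (auto simp: E_def a_def)
  finally have 1: "(\<Sum>k<N. v k) = 1" .
  have 2: "mixture N v (\<lambda>k. tensor_vec n (h k)) i j = (\<Sum>k\<in>S. of_real (w k) * F k i j)"
    if ij: "i \<in> ?I" "j \<in> ?I" for i j
  proof -
    have "mixture N v (\<lambda>k. tensor_vec n (h k)) i j
        = (\<Sum>k<N. if k < card T then of_real (u (b k)) * F (b k) i j else 0)"
      unfolding mixture_def by (intro sum.cong) (auto simp: v_def h_def F_def)
    also have "\<dots> = (\<Sum>k\<in>T. of_real (u k) * F k i j)" by (rule sum_eq)
    also have "\<dots> = (\<Sum>k\<in>S. of_real (w k) * F k i j)"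
    proof (rule complex_eqI)
      have "Some ((i, j), True) \<in> E" "Some ((i, j), False) \<in> E" using ij by (auto simp: E_def)
      from this[THEN bspec[OF eq]]
      show "Re (\<Sum>k\<in>T. of_real (u k) * F k i j) = Re (\<Sum>k\<in>S. of_real (w k) * F k i j)"
        "Im (\<Sum>k\<in>T. of_real (u k) * F k i j) = Im (\<Sum>k\<in>S. of_real (w k) * F k i j)"
        by (simp_all add: a_def)
    qed
    finally show ?thesis .
  qed
  have 3: "\<forall>k. 0 \<le> v k" using T(3) bT by (auto simp: v_def)
  have 4: "\<forall>k. h k \<in> K" using T(1) bT assms(3) \<phi>0 by (auto simp: h_def)
  from 2 have "\<forall>i\<in>idx n. \<forall>j\<in>idx n. mixture N v (\<lambda>k. tensor_vec n (h k)) i j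
       = (\<Sum>k\<in>S. of_real (w k) * (tensor_vec n (f k) i * cnj (tensor_vec n (f k) j)))"
    unfolding F_def by (intro ballI)
  from that[OF 3 4 1 this] show thesis .
qed

text \<open>Tychonoff's theorem for whole sequences, cut by a closed condition on the first
  \<open>N\<close> weights.\<close>

lemma compact_weighted_configurations:
  fixes K :: "'v::t2_space set"
  assumes "compact K"
  shows "compact {F :: nat \<Rightarrow> real \<times> 'v. (\<forall>k. F k \<in> {0..1} \<times> K) \<and> (\<Sum>k<N. fst (F k)) = 1}"
proof -
  have "compactin (product_topology (\<lambda>_. euclidean) UNIV) (PiE (UNIV::nat set) (\<lambda>_. {0..1::real} \<times> K))"
    unfolding compactin_PiE using assms by (auto intro!: compact_Times)
  then have c: "compact (PiE (UNIV::nat set) (\<lambda>_. {0..1::real} \<times> K))"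
    by (simp add: euclidean_product_topology)
  have "closed {F :: nat \<Rightarrow> real \<times> 'v. (\<Sum>k<N. fst (F k)) = 1}"
    by (intro closed_Collect_eq continuous_intros continuous_on_product_coordinates)
  with c have "compact (PiE (UNIV::nat set) (\<lambda>_. {0..1::real} \<times> K) \<inter> {F. (\<Sum>k<N. fst (F k)) = 1})"
    by (rule compact_Int_closed)
  moreover have "PiE (UNIV::nat set) (\<lambda>_. {0..1::real} \<times> K) \<inter> {F. (\<Sum>k<N. fst (F k)) = 1}
     = {F. (\<forall>k. F k \<in> {0..1} \<times> K) \<and> (\<Sum>k<N. fst (F k)) = 1}" by (auto simp: PiE_def Pi_def)
  ultimately show ?thesis by simp
qed

text \<open>The mixture of minimal Frobenius norm is unique, hence fixed by every isometric symmetry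
  of \<open>K\<close>; it plays the role of the Haar average.\<close>

lemma exists_invariant_mixture:
  fixes K :: "(complex ^ 'i::finite) set"
  assumes K: "compact K" "K \<noteq> {}"
  shows "\<exists>m w f. (\<forall>k. 0 \<le> w k) \<and> (\<forall>k. f k \<in> K) \<and> (\<Sum>k<m. w k) = 1 \<and>
    (\<forall>T. (\<forall>\<phi>\<in>K. T \<phi> \<in> K) \<longrightarrow> (\<forall>\<phi>\<in>K. \<forall>\<eta>\<in>K. herm_prod (T \<phi>) (T \<eta>) = herm_prod \<phi> \<eta>) \<longrightarrow>
      (\<forall>i\<in>idx n. \<forall>j\<in>idx n. mixture m w (\<lambda>k. tensor_vec n (T (f k))) i j = mixture m w (\<lambda>k. tensor_vec n (f k)) i j))"
proof -
  define N where "N = 2 * CARD('i)^n * CARD('i)^n + 1"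
  define C where "C = {F :: nat \<Rightarrow> real \<times> (complex ^ 'i). (\<forall>k. F k \<in> {0..1} \<times> K) \<and> (\<Sum>k<N. fst (F k)) = 1}"
  define M where "M = (\<lambda>F :: nat \<Rightarrow> real \<times> (complex ^ 'i). mixture N (\<lambda>k. fst (F k)) (\<lambda>k. tensor_vec n (snd (F k))))"
  have C: "compact C" unfolding C_def by (rule compact_weighted_configurations[OF K(1)])
  \<comment> \<open>Every finite mixture, of whatever length, has the norm of some configuration in
    \<open>C\<close>; so a minimum over \<open>C\<close> is a minimum over all mixtures.\<close>
  have inC: "\<exists>F\<in>C. frobenius_sq n (M F) = frobenius_sq n A"
    if hyp: "finite S" "\<forall>k\<in>S. 0 \<le> w k" "\<forall>k\<in>S. f k \<in> K" "(\<Sum>k\<in>S. w k) = 1"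
      "\<And>i j. A i j = (\<Sum>k\<in>S. of_real (w k) * (tensor_vec n (f k) i * cnj (tensor_vec n (f k) j)))"
    for A S w and f :: "nat \<Rightarrow> complex ^ 'i"
  proof -
    obtain v h where
      vh: "\<forall>k. 0 \<le> v k" "\<forall>k. h k \<in> K" "(\<Sum>k<N. v k) = 1"
      "\<forall>i\<in>idx n. \<forall>j\<in>idx n. mixture N v (\<lambda>k. tensor_vec n (h k)) i j
         = (\<Sum>k\<in>S. of_real (w k) * (tensor_vec n (f k) i * cnj (tensor_vec n (f k) j)))"
      using mixture_tensor_vec_caratheodory[OF hyp(1-4) K(2) N_def] .
    \<comment> \<open>Weights beyond \<open>N\<close> are not controlled by their sum, and
      \<open>C\<close> requires all of them to lie in \<open>{0..1}\<close>.\<close>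
    define v' where "v' = (\<lambda>k. if k < N then v k else 0)"
    have "v k \<le> 1" if "k < N" for k
      unfolding vh(3)[symmetric] using vh(1) that by (intro member_le_sum) auto
    then have "(\<lambda>k. (v' k, h k)) \<in> C" using vh by (auto simp: C_def v'_def)
    moreover have "frobenius_sq n (M (\<lambda>k. (v' k, h k))) = frobenius_sq n A"
      using vh(4) by (auto simp: frobenius_sq_def M_def mixture_def v'_def hyp(5))
    ultimately show ?thesis by blast
  qed
  obtain \<phi>0 where \<phi>0: "\<phi>0 \<in> K" using K(2) by auto
  have "C \<noteq> {}"
    using inC[of "{0}" "\<lambda>_. 1" "\<lambda>_. \<phi>0", OF _ _ _ _ refl] \<phi>0 by auto
  moreover have "continuous_on C (\<lambda>F. frobenius_sq n (M F))"
    unfolding frobenius_sq_def M_def mixture_def tensor_vec_def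
    by (intro continuous_intros continuous_on_subset[OF continuous_on_product_coordinates]) auto
  ultimately obtain F where F: "F \<in> C" and Fmin: "\<And>G. G \<in> C \<Longrightarrow> frobenius_sq n (M F) \<le> frobenius_sq n (M G)"
    using continuous_attains_inf[OF C] by blast
  define w where "w = (\<lambda>k. fst (F k))"
  define f where "f = (\<lambda>k. snd (F k))"
  have w: "0 \<le> w k" "(\<Sum>k<N. w k) = 1" and f: "f k \<in> K" for k
    using F by (auto simp: C_def w_def f_def mem_Times_iff)
  have "mixture N w (\<lambda>k. tensor_vec n (T (f k))) i j = mixture N w (\<lambda>k. tensor_vec n (f k)) i j"
    if T: "\<forall>\<phi>\<in>K. T \<phi> \<in> K" "\<forall>\<phi>\<in>K. \<forall>\<eta>\<in>K. herm_prod (T \<phi>) (T \<eta>) = herm_prod \<phi> \<eta>"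
      and ij: "i \<in> idx n" "j \<in> idx n" for T i j
  proof -
    define A where "A = mixture N w (\<lambda>k. tensor_vec n (f k))"
    define B where "B = mixture N w (\<lambda>k. tensor_vec n (T (f k)))"
    have MF: "M F = A" by (simp add: M_def A_def w_def f_def)
    have "complex_of_real (frobenius_sq n B) = complex_of_real (frobenius_sq n A)"
      using T(2) f unfolding A_def B_def frobenius_sq_mixture by simp
    then have AB: "frobenius_sq n B = frobenius_sq n A" by simp
    \<comment> \<open>The midpoint of the mixture and its image under \<open>T\<close>, written as a
      mixture of \<open>N + N\<close> atoms with halved weights. Minimality and the parallelogram
      identity then force the two to coincide.\<close>
    let ?w = "\<lambda>k. (if k < N then w k else w (k - N)) / 2"
    let ?f = "\<lambda>k. if k < N then f k else T (f (k - N))"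
    have split: "(\<Sum>k<N + N. G k) = (\<Sum>k<N. G k) + (\<Sum>k<N. G (k + N))" for G :: "nat \<Rightarrow> 'z::comm_monoid_add"
    proof -
      have "(\<Sum>k<N + N. G k) = (\<Sum>k<N. G k) + (\<Sum>k=N..<N + N. G k)"
        by (metis add.commute atLeast0LessThan le_add1 sum.atLeastLessThan_concat zero_le)
      also have "(\<Sum>k=N..<N + N. G k) = (\<Sum>k<N. G (k + N))"
        using sum.shift_bounds_nat_ivl[of G 0 N N] by (simp add: atLeast0LessThan)
      finally show ?thesis .
    qed
    have "\<exists>G\<in>C. frobenius_sq n (M G) = frobenius_sq n (\<lambda>i j. (A i j + B i j) / 2)"
    proof (rule inC[of "{..<N + N}" ?w ?f])
      show "(\<Sum>k<N + N. ?w k) = 1"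
        unfolding split using w(2) by (simp flip: sum_divide_distrib)
      show "(A i j + B i j) / 2 = (\<Sum>k<N + N. of_real (?w k) * (tensor_vec n (?f k) i * cnj (tensor_vec n (?f k) j)))" for i j
        unfolding split by (simp add: A_def B_def mixture_def add_divide_distrib sum_divide_distrib)
    qed (use w f T(1) in auto)
    then have "frobenius_sq n A \<le> frobenius_sq n (\<lambda>i j. (A i j + B i j) / 2)" using Fmin MF by metis
    then have "frobenius_sq n (\<lambda>i j. A i j - B i j) \<le> 0"
      unfolding frobenius_sq_parallelogram AB by simp
    then have "A i j - B i j = 0" by (rule frobenius_sq_eq_0) (use ij in auto)
    then show ?thesis by (simp add: A_def B_def)
  qed
  with w f show ?thesis by blast
qed

section \<open>Commuting partial isometries\<close>

text \<open>Reads a matrix from the n-th power of R to that of A as a vector of the joint space,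
  identifying lists of pairs with pairs of lists.\<close>

definition vectorize :: "('a list \<Rightarrow> 'r list \<Rightarrow> complex) \<Rightarrow> ('a \<times> 'r) list \<Rightarrow> complex" where
  "vectorize X zs = X (map fst zs) (map snd zs)"

definition block :: "(('a \<times> 'r) list \<Rightarrow> ('a \<times> 'r) list \<Rightarrow> complex) \<Rightarrow> 'a list \<Rightarrow> 'a list \<Rightarrow> 'r list \<Rightarrow> 'r list \<Rightarrow> complex" where
  "block M as bs rs ss = M (zip as rs) (zip bs ss)"

lemma zip_in_idx [simp]: "as \<in> idx n \<Longrightarrow> rs \<in> idx n \<Longrightarrow> zip as rs \<in> idx n"
  by (simp add: idx_def)

lemma vectorize_zip [simp]: "as \<in> idx n \<Longrightarrow> rs \<in> idx n \<Longrightarrow> vectorize X (zip as rs) = X as rs"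
  by (simp add: vectorize_def idx_def)

lemma vectorize_unzip: "zs \<in> idx n \<Longrightarrow> vectorize (\<lambda>as rs. x (zip as rs)) zs = x zs"
  by (simp add: vectorize_def zip_map_fst_snd)

lemma sum_idx_zip:
  "(\<Sum>zs\<in>idx n. G zs) = (\<Sum>as\<in>idx n. \<Sum>rs\<in>idx n. G (zip as rs))"
proof -
  have "(\<Sum>zs\<in>idx n. G zs) = (\<Sum>(as, rs)\<in>idx n \<times> idx n. G (zip as rs))"
    by (rule sum.reindex_bij_witness[of _ "\<lambda>(as, rs). zip as rs" "\<lambda>zs. (map fst zs, map snd zs)"])
       (auto simp: idx_def zip_map_fst_snd)
  then show ?thesis by (simp add: sum.cartesian_product)
qed

lemma sesq_form_cong:
  assumes "\<And>i. i \<in> I \<Longrightarrow> x i = x' i" "\<And>i. i \<in> I \<Longrightarrow> y i = y' i"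
  shows "sesq_form I M x y = sesq_form I M x' y'"
  unfolding sesq_form_def using assms by (intro sum.cong) auto

lemma sesq_form_vectorize:
  "sesq_form (idx n) M (vectorize X) (vectorize Y) = (\<Sum>as\<in>idx n. \<Sum>bs\<in>idx n. \<Sum>rs\<in>idx n. \<Sum>ss\<in>idx n.
     cnj (X as rs) * block M as bs rs ss * Y bs ss)"
proof -
  have "sesq_form (idx n) M (vectorize X) (vectorize Y) = (\<Sum>as\<in>idx n. \<Sum>rs\<in>idx n. \<Sum>bs\<in>idx n. \<Sum>ss\<in>idx n.
     cnj (X as rs) * block M as bs rs ss * Y bs ss)"
    unfolding sesq_form_def sum_idx_zip by (intro sum.cong refl) (simp add: block_def)
  also have "\<dots> = (\<Sum>as\<in>idx n. \<Sum>bs\<in>idx n. \<Sum>rs\<in>idx n. \<Sum>ss\<in>idx n.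
     cnj (X as rs) * block M as bs rs ss * Y bs ss)"
    by (intro sum.cong[OF refl] sum.swap)
  finally show ?thesis .
qed

text \<open>Right multiplication of the row \<open>y\<close> by \<open>C\<close> is the transpose of
  \<open>C\<close> acting on a column, hence the transpose in the hypothesis. Passed through
  \<open>N\<close> to the other argument it becomes right multiplication by
  \<open>adj C\<close>.\<close>

lemma bilinear_commute_shift:
  fixes N :: "'r::finite list \<Rightarrow> 'r list \<Rightarrow> complex"
  assumes "commutes n N (\<lambda>s t. C t s)"
  shows "(\<Sum>rs\<in>idx n. \<Sum>ss\<in>idx n. cnj (x rs) * N rs ss * (\<Sum>t\<in>idx n. y t * C t ss))
    = (\<Sum>u\<in>idx n. \<Sum>t\<in>idx n. cnj (\<Sum>rs\<in>idx n. x rs * cnj (C u rs)) * N u t * y t)"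
proof -
  let ?I = "idx n :: 'r list set"
  define xr where "xr = (\<lambda>(_::unit) rs. cnj (x rs))"
  define yc where "yc = (\<lambda>t (_::unit). y t)"
  define D where "D = (\<lambda>s t. C t s)"
  have L: "(\<Sum>rs\<in>?I. \<Sum>ss\<in>?I. cnj (x rs) * N rs ss * (\<Sum>t\<in>?I. y t * C t ss))
      = mat_mul ?I xr (mat_mul ?I N (mat_mul ?I D yc)) () ()"
    by (simp add: mat_mul_def xr_def yc_def D_def sum_distrib_left mult_ac)
  have R: "(\<Sum>u\<in>?I. \<Sum>t\<in>?I. cnj (\<Sum>rs\<in>?I. x rs * cnj (C u rs)) * N u t * y t)
      = mat_mul ?I (mat_mul ?I xr D) (mat_mul ?I N yc) () ()"
    by (simp add: mat_mul_def xr_def yc_def D_def sum_distrib_left mult.assoc)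
  have "mat_mul ?I xr (mat_mul ?I (mat_mul ?I N D) yc) () () = mat_mul ?I xr (mat_mul ?I (mat_mul ?I D N) yc) () ()"
  proof (rule mat_mul_cong[OF refl])
    fix k assume k: "k \<in> ?I"
    show "mat_mul ?I (mat_mul ?I N D) yc k () = mat_mul ?I (mat_mul ?I D N) yc k ()"
      by (rule mat_mul_cong[OF _ refl]) (use assms k in \<open>auto simp: commutes_def D_def\<close>)
  qed
  then show ?thesis unfolding L R by (simp add: mat_mul_assoc)
qed

definition perm_invariant :: "nat \<Rightarrow> ('r list \<Rightarrow> 'r list \<Rightarrow> complex) \<Rightarrow> bool" where
  "perm_invariant n B \<longleftrightarrow> (\<forall>p xs ys. p permutes {..<n} \<longrightarrow> xs \<in> idx n \<longrightarrow> ys \<in> idx n \<longrightarrow>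
     B (perm_list p n xs) (perm_list p n ys) = B xs ys)"

text \<open>Right multiplication acts on the R factors alone, so the shift applies in each block
  separately; \<open>C\<close> and \<open>adj C\<close> are adjoint for the form of
  \<open>M\<close>.\<close>

lemma sesq_form_vectorize_shift:
  fixes M :: "('a::finite \<times> 'r::finite) list \<Rightarrow> ('a \<times> 'r) list \<Rightarrow> complex"
  assumes M: "\<forall>as\<in>idx n. \<forall>bs\<in>idx n. \<forall>B. perm_invariant n B \<longrightarrow> commutes n (block M as bs) B"
    and C: "perm_invariant n C"
  shows "sesq_form (idx n) M (vectorize X) (vectorize (mat_mul (idx n) Y C))
    = sesq_form (idx n) M (vectorize (mat_mul (idx n) X (adj C))) (vectorize Y)"
  unfolding sesq_form_vectorize
proof (rule sum.cong[OF refl], rule sum.cong[OF refl])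
  fix as bs :: "'a list" assume "as \<in> idx n" "bs \<in> idx n"
  moreover have "perm_invariant n (\<lambda>s t. C t s)" using C by (auto simp: perm_invariant_def)
  ultimately have "commutes n (block M as bs) (\<lambda>s t. C t s)" using M by blast
  from bilinear_commute_shift[OF this, of "X as" "Y bs"]
  show "(\<Sum>rs\<in>idx n. \<Sum>ss\<in>idx n. cnj (X as rs) * block M as bs rs ss * mat_mul (idx n) Y C bs ss)
    = (\<Sum>rs\<in>idx n. \<Sum>ss\<in>idx n. cnj (mat_mul (idx n) X (adj C) as rs) * block M as bs rs ss * Y bs ss)"
    by (simp only: mat_mul_def adj_def)
qed

lemma perm_invariant_adj: "perm_invariant n B \<Longrightarrow> perm_invariant n (adj B)"
  by (auto simp: perm_invariant_def adj_def)

text \<open>Writing \<open>X' = X W\<^sup>*\<close> and \<open>P = X W\<^sup>* W\<close>, all of \<open>\<langle>X, P\<rangle>\<close>, \<open>\<langle>P, X\<rangle>\<close> and \<open>\<langle>P, P\<rangle>\<close> equal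
  \<open>\<langle>X', X'\<rangle>\<close> in the form given by \<open>M\<close>, because \<open>W\<close> is a partial isometry commuting with \<open>M\<close>;
  positivity on \<open>X - P\<close> then bounds \<open>\<langle>X', X'\<rangle>\<close> by \<open>\<langle>X, X\<rangle>\<close>.\<close>

lemma domination_transfer:
  fixes M :: "('a::finite \<times> 'r::finite) list \<Rightarrow> ('a \<times> 'r) list \<Rightarrow> complex"
  assumes M: "\<forall>as\<in>idx n. \<forall>bs\<in>idx n. \<forall>B. perm_invariant n B \<longrightarrow> commutes n (block M as bs) B"
    and psd: "psd_on (idx n) M"
    and W: "perm_invariant n W"
    and W3: "\<And>ts rs. ts \<in> idx n \<Longrightarrow> rs \<in> idx n \<Longrightarrow> mat_mul (idx n) W (mat_mul (idx n) (adj W) W) ts rs = W ts rs"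
    and \<Psi>: "\<And>as rs. as \<in> idx n \<Longrightarrow> rs \<in> idx n \<Longrightarrow> \<Psi> as rs = mat_mul (idx n) \<Phi> W as rs"
    and c: "0 \<le> c"
    and dom: "\<And>x. (cmod (inner_idx n x (vectorize \<Phi>)))\<^sup>2 \<le> c * Re (sesq_form (idx n) M x x)"
  shows "(cmod (inner_idx n x (vectorize \<Psi>)))\<^sup>2 \<le> c * Re (sesq_form (idx n) M x x)"
proof -
  let ?I = "idx n :: 'r list set"
  let ?B = "\<lambda>X Y. sesq_form (idx n) M (vectorize X) (vectorize Y)"
  define X where "X = (\<lambda>as rs. x (zip as rs))"
  define X' where "X' = mat_mul ?I X (adj W)"
  define P where "P = mat_mul ?I X' W"
  note shift = sesq_form_vectorize_shift[OF M]
  have xX: "sesq_form (idx n) M x x = ?B X X"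
    by (rule sesq_form_cong) (auto simp: X_def vectorize_unzip)
  \<comment> \<open>Moving \<open>W\<close> to the other side replaces the test vector
    \<open>X\<close> by \<open>X'\<close>, to which the bound for \<Phi> applies.\<close>
  have "inner_idx n x (vectorize \<Psi>) = (\<Sum>as\<in>idx n. \<Sum>rs\<in>?I. cnj (X as rs) * (\<Sum>t\<in>?I. \<Phi> as t * W t rs))"
    unfolding inner_idx_def sum_idx_zip by (intro sum.cong refl) (simp add: X_def \<Psi> mat_mul_def)
  also have "\<dots> = (\<Sum>as\<in>idx n. \<Sum>t\<in>?I. \<Sum>rs\<in>?I. cnj (X as rs) * (\<Phi> as t * W t rs))"
    unfolding sum_distrib_left by (intro sum.cong[OF refl] sum.swap)
  also have "\<dots> = (\<Sum>as\<in>idx n. \<Sum>t\<in>?I. cnj (X' as t) * \<Phi> as t)"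
    by (simp add: X'_def mat_mul_def adj_def sum_distrib_left sum_distrib_right mult_ac)
  also have "\<dots> = inner_idx n (vectorize X') (vectorize \<Phi>)"
    unfolding inner_idx_def sum_idx_zip by (intro sum.cong refl) simp
  finally have ipeq: "inner_idx n x (vectorize \<Psi>) = inner_idx n (vectorize X') (vectorize \<Phi>)" .
  have XP: "?B X P = ?B X' X'"
    unfolding P_def shift[OF W] X'_def[symmetric] ..
  have PX: "?B P X = ?B X' X'"
    using shift[OF perm_invariant_adj[OF W], of X' X] by (simp add: P_def X'_def)
  have "mat_mul ?I P (adj W) as rs = X' as rs" if "rs \<in> ?I" for as rs
  proof -
    have "mat_mul ?I P (adj W) as rs = mat_mul ?I X (mat_mul ?I (mat_mul ?I (adj W) W) (adj W)) as rs"
      by (simp add: P_def X'_def mat_mul_assoc)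
    also have "mat_mul ?I (mat_mul ?I (adj W) W) (adj W) = adj (mat_mul ?I W (mat_mul ?I (adj W) W))"
      by (simp add: adj_mat_mul)
    also have "mat_mul ?I X (adj (mat_mul ?I W (mat_mul ?I (adj W) W))) as rs = mat_mul ?I X (adj W) as rs"
      by (rule mat_mul_cong[OF refl]) (use that W3 in \<open>auto simp: adj_def\<close>)
    finally show ?thesis by (simp add: X'_def)
  qed
  then have "?B (mat_mul ?I P (adj W)) X' = ?B X' X'"
    by (intro sesq_form_cong) (auto simp: vectorize_def idx_def)
  then have PP: "?B P P = ?B X' X'" using shift[OF W, of P X'] by (simp add: P_def)
  have "0 \<le> sesq_form (idx n) M (\<lambda>i. vectorize X i - vectorize P i) (\<lambda>i. vectorize X i - vectorize P i)"
    by (rule psd_onD[OF psd])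
  then have "0 \<le> ?B X X - ?B X' X'"
    by (simp add: sesq_form_diff_left sesq_form_diff_right XP PX PP)
  then have le: "Re (?B X' X') \<le> Re (?B X X)" by (simp add: less_eq_complex_def)
  have "(cmod (inner_idx n x (vectorize \<Psi>)))\<^sup>2 \<le> c * Re (?B X' X')" unfolding ipeq by (rule dom)
  also have "\<dots> \<le> c * Re (?B X X)" by (rule mult_left_mono[OF le c])
  finally show ?thesis by (simp only: xX)
qed

section \<open>Generalized inverses and the rank of the purified operator\<close>

lemma mat_mul_adj_eq_0:
  assumes "finite I" "mat_mul I A (adj A) x x = 0" "k \<in> I"
  shows "A x k = 0"
proof -
  have "complex_of_real (\<Sum>k\<in>I. (cmod (A x k))\<^sup>2) = 0"
    using assms(2) unfolding mat_mul_def adj_def by (simp only: of_real_sum complex_norm_square)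
  then have "(\<Sum>k\<in>I. (cmod (A x k))\<^sup>2) = 0" by (simp only: of_real_eq_0_iff)
  then show ?thesis using assms by (subst (asm) sum_nonneg_eq_0_iff) auto
qed

lemma psd_adj: "psd_on UNIV \<sigma> \<Longrightarrow> adj (\<sigma> :: 'a::finite \<Rightarrow> _) = \<sigma>"
proof (intro ext)
  fix a b :: 'a assume psd: "psd_on UNIV \<sigma>"
  have "sesq_form UNIV \<sigma> (\<lambda>i. id_mat i a) (\<lambda>i. id_mat i b) = \<sigma> a b" for a b
    by (simp add: sesq_form_def id_mat_def if_distrib[of cnj] of_bool_def if_distrib[of "\<lambda>x. x * _"]
        if_distrib[of "\<lambda>x. _ * x"] cong: if_cong)
  from psd_sesq_form_herm[OF psd, of "\<lambda>i. id_mat i a" "\<lambda>i. id_mat i b", unfolded this]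
  show "adj \<sigma> a b = \<sigma> a b" by (simp add: adj_def)
qed

text \<open>The columns of \<open>Z\<close> are a maximal system orthonormal for \<sigma>. Nullity
  of the residuals factors \<sigma> through \<open>m\<close> columns, which later yields a
  purification; with orthonormality it makes \<open>Z\<close> times \<open>adj Z\<close> a reflexive
  generalized inverse.\<close>

lemma psd_generalized_inverse:
  fixes \<sigma> :: "'a::finite \<Rightarrow> 'a \<Rightarrow> complex"
  assumes psd: "psd_on UNIV \<sigma>" and bound: "\<And>m e. orthonormal UNIV \<sigma> m e \<Longrightarrow> m \<le> D"
  obtains m Z where "m \<le> D"
    "mat_mul {..<m} (mat_mul UNIV \<sigma> Z) (adj (mat_mul UNIV \<sigma> Z)) = \<sigma>"
    "mat_mul UNIV \<sigma> (mat_mul UNIV (mat_mul {..<m} Z (adj Z)) \<sigma>) = \<sigma>"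
    "mat_mul UNIV (mat_mul {..<m} Z (adj Z)) (mat_mul UNIV \<sigma> (mat_mul {..<m} Z (adj Z))) = mat_mul {..<m} Z (adj Z)"
proof -
  obtain m e where m: "m \<le> D" and e: "orthonormal UNIV \<sigma> m e"
    and res: "\<And>x y. sesq_form UNIV \<sigma> y (\<lambda>i. x i - (\<Sum>k<m. sesq_form UNIV \<sigma> (e k) x * e k i)) = 0"
    by (rule psd_maximal_orthonormal_system[OF psd bound]) (assumption, rule that, assumption+)
  define Z where "Z = (\<lambda>a k. e k a)"
  have h: "adj \<sigma> = \<sigma>" by (rule psd_adj[OF psd])
  have on: "mat_mul UNIV (adj Z) (mat_mul UNIV \<sigma> Z) k l = id_mat k l" if "k < m" "l < m" for k l
  proof -
    have "mat_mul UNIV (adj Z) (mat_mul UNIV \<sigma> Z) k l = sesq_form UNIV \<sigma> (e k) (e l)"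
      by (simp add: mat_mul_def adj_def Z_def sesq_form_def sum_distrib_left mult.assoc)
    then show ?thesis using e that by (simp add: orthonormal_def id_mat_def)
  qed
  have 1: "mat_mul {..<m} (mat_mul UNIV \<sigma> Z) (mat_mul UNIV (adj Z) \<sigma>) = \<sigma>"
  proof (intro ext)
    fix a b :: 'a
    let ?a = "\<lambda>i. id_mat i a" and ?b = "\<lambda>i. id_mat i b"
    have delta: "(\<Sum>i\<in>UNIV. id_mat i a * F i) = F a" for a and F :: "'a \<Rightarrow> complex"
      by (simp add: id_mat_def of_bool_def if_distrib[of "\<lambda>x. x * _"] cong: if_cong)
    have c: "cnj (id_mat i a) = id_mat i a" for i by (simp add: id_mat_def)
    have s1: "sesq_form UNIV \<sigma> ?a y = (\<Sum>j\<in>UNIV. \<sigma> a j * y j)" for y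
      by (simp add: sesq_form_def c delta mult.assoc flip: sum_distrib_left)
    have s2: "sesq_form UNIV \<sigma> y ?b = (\<Sum>i\<in>UNIV. cnj (y i) * \<sigma> i b)" for y
      using delta[of b] by (simp add: sesq_form_def mult.commute[of _ "id_mat _ b"])
    have "0 = sesq_form UNIV \<sigma> ?a ?b - (\<Sum>k<m. sesq_form UNIV \<sigma> (e k) ?b * sesq_form UNIV \<sigma> ?a (e k))"
      using res[of ?a ?b] by (simp add: sesq_form_diff_right sesq_form_sum_right)
    also have "sesq_form UNIV \<sigma> ?a ?b = \<sigma> a b"
      unfolding s1 using delta[of b "\<sigma> a"] by (simp add: mult.commute)
    finally show "mat_mul {..<m} (mat_mul UNIV \<sigma> Z) (mat_mul UNIV (adj Z) \<sigma>) a b = \<sigma> a b"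
      by (simp add: s1 s2 mat_mul_def Z_def adj_def mult.commute)
  qed
  show thesis
  proof (rule that[OF m, of Z])
    show "mat_mul {..<m} (mat_mul UNIV \<sigma> Z) (adj (mat_mul UNIV \<sigma> Z)) = \<sigma>"
      using 1 by (simp add: adj_mat_mul h)
    show "mat_mul UNIV \<sigma> (mat_mul UNIV (mat_mul {..<m} Z (adj Z)) \<sigma>) = \<sigma>"
      using 1 by (simp add: mat_mul_assoc)
    have "mat_mul {..<m} Z (mat_mul {..<m} (mat_mul UNIV (adj Z) (mat_mul UNIV \<sigma> Z)) (adj Z)) = mat_mul {..<m} Z (adj Z)"
    proof (intro ext)
      fix a b
      have "mat_mul {..<m} (mat_mul UNIV (adj Z) (mat_mul UNIV \<sigma> Z)) (adj Z) k b = adj Z k b" if k: "k < m" for k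
      proof -
        have "mat_mul {..<m} (mat_mul UNIV (adj Z) (mat_mul UNIV \<sigma> Z)) (adj Z) k b = mat_mul {..<m} id_mat (adj Z) k b"
          by (rule mat_mul_cong[OF _ refl]) (use on k in auto)
        then show ?thesis using k by simp
      qed
      then show "mat_mul {..<m} Z (mat_mul {..<m} (mat_mul UNIV (adj Z) (mat_mul UNIV \<sigma> Z)) (adj Z)) a b
          = mat_mul {..<m} Z (adj Z) a b"
        by (intro mat_mul_cong) auto
    qed
    then show "mat_mul UNIV (mat_mul {..<m} Z (adj Z)) (mat_mul UNIV \<sigma> (mat_mul {..<m} Z (adj Z))) = mat_mul {..<m} Z (adj Z)"
      by (simp add: mat_mul_assoc)
  qed
qed

text \<open>The \<open>m\<^sup>n\<close> products of an orthonormal system yield orthonormal vectors in the space of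
  dimension \<open>CARD('r)\<^sup>n\<close>.\<close>

lemma orthonormal_system_le_card:
  fixes \<Psi> :: "'a::finite list \<Rightarrow> 'r::finite list \<Rightarrow> complex"
  assumes n: "n > 0"
    and \<Psi>: "\<And>as bs. as \<in> idx n \<Longrightarrow> bs \<in> idx n \<Longrightarrow> mat_mul (idx n) \<Psi> (adj \<Psi>) as bs = tensor_mat n \<sigma> as bs"
    and e: "orthonormal UNIV \<sigma> m e"
  shows "m \<le> CARD('r)"
proof (rule ccontr)
  assume "\<not> m \<le> CARD('r)"
  then have lt: "CARD('r) ^ n < m ^ n" using n by (intro power_strict_mono) auto
  let ?A = "idx n :: 'a list set" and ?R = "idx n :: 'r list set"
  define S where "S = {ks. set ks \<subseteq> {..<m} \<and> length ks = n}"
  have S: "finite S" "card S = m ^ n"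
    unfolding S_def by (auto simp: finite_lists_length_eq card_lists_length_eq)
  define Em where "Em = (\<lambda>k a. cnj (e k a))"
  define V where "V = mat_mul ?A (tensor_mat n Em) \<Psi>"
  have E: "mat_mul UNIV Em (mat_mul UNIV \<sigma> (adj Em)) k l = id_mat k l" if "k < m" "l < m" for k l
  proof -
    have "mat_mul UNIV Em (mat_mul UNIV \<sigma> (adj Em)) k l = sesq_form UNIV \<sigma> (e k) (e l)"
      by (simp add: mat_mul_def adj_def Em_def sesq_form_def sum_distrib_left mult.assoc)
    then show ?thesis using e that by (simp add: orthonormal_def id_mat_def)
  qed
  \<comment> \<open>The rows of \<open>V\<close> are orthonormal because the Gram matrix of \<Psi>
    is the tensor power of \<sigma>, for which the products of the \<open>e k\<close> are
    orthonormal.\<close>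
  have VV: "mat_mul ?R V (adj V) ks ls = id_mat ks ls" if ks: "ks \<in> S" "ls \<in> S" for ks ls
  proof -
    have "mat_mul ?R V (adj V) ks ls
        = mat_mul ?A (tensor_mat n Em) (mat_mul ?A (mat_mul ?R \<Psi> (adj \<Psi>)) (tensor_mat n (adj Em))) ks ls"
      by (simp add: V_def adj_mat_mul mat_mul_assoc adj_tensor_mat)
    also have "\<dots> = mat_mul ?A (tensor_mat n Em) (mat_mul ?A (tensor_mat n \<sigma>) (tensor_mat n (adj Em))) ks ls"
      by (rule mat_mul_cong[OF refl], rule mat_mul_cong[OF _ refl]) (use \<Psi> in auto)
    also have "\<dots> = tensor_mat n (mat_mul UNIV Em (mat_mul UNIV \<sigma> (adj Em))) ks ls"
      by (simp add: mat_mul_tensor_mat)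
    also have "\<dots> = tensor_mat n id_mat ks ls"
      unfolding tensor_mat_def using ks
      by (intro prod.cong refl E) (auto simp: S_def subset_iff)
    also have "\<dots> = id_mat ks ls" using ks by (intro tensor_mat_id_mat) (auto simp: S_def idx_def)
    finally show ?thesis .
  qed
  have "card ?R < card S" using lt by (simp add: S card_idx)
  \<comment> \<open>More rows than columns give a linear dependence; pairing it with row
    \<open>ks\<close> isolates the coefficient \<open>t ks\<close>.\<close>
  from exists_nontrivial_solution[OF finite_idx S(1) this, of "\<lambda>rs ks. cnj (V ks rs)"]
  obtain t ks where t: "ks \<in> S" "t ks \<noteq> 0" "\<forall>rs\<in>?R. (\<Sum>ls\<in>S. cnj (V ls rs) * t ls) = 0"
    by auto
  have "0 = (\<Sum>rs\<in>?R. V ks rs * (\<Sum>ls\<in>S. cnj (V ls rs) * t ls))" using t(3) by simp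
  also have "\<dots> = (\<Sum>ls\<in>S. \<Sum>rs\<in>?R. V ks rs * (cnj (V ls rs) * t ls))"
    unfolding sum_distrib_left by (rule sum.swap)
  also have "\<dots> = (\<Sum>ls\<in>S. mat_mul ?R V (adj V) ks ls * t ls)"
    by (simp add: mat_mul_def adj_def sum_distrib_right mult.assoc)
  also have "\<dots> = (\<Sum>ls\<in>S. if ls = ks then t ls else 0)"
    using t(1) VV by (intro sum.cong) (auto simp: id_mat_def)
  also have "\<dots> = t ks" using t(1) S(1) by simp
  finally show False using t(2) by simp
qed

section \<open>Purifications\<close>

lemma tensor_mat_perm_list:
  assumes "p permutes {..<n}"
  shows "tensor_mat n A (perm_list p n xs) (perm_list p n ys) = tensor_mat n A xs ys"
proof -
  have "tensor_mat n A (perm_list p n xs) (perm_list p n ys) = (\<Prod>k<n. A (xs ! p k) (ys ! p k))"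
    by (simp add: tensor_mat_def nth_perm_list)
  also have "\<dots> = (\<Prod>k<n. A (xs ! k) (ys ! k))"
    using prod.permute[OF assms, of "\<lambda>k. A (xs ! k) (ys ! k)"] by (simp add: o_def)
  finally show ?thesis by (simp add: tensor_mat_def)
qed

lemma bij_perm_list:
  assumes p: "p permutes {..<n}"
  shows "bij_betw (perm_list p n) (idx n) (idx n)"
proof (rule bij_betw_byWitness[where f' = "perm_list (inv p) n"])
  have *: "perm_list p n (perm_list q n xs) = xs"
    if "p permutes {..<n}" "\<And>k. q (p k) = k" "xs \<in> idx n" for p q and xs :: "'x list"
    using that permutes_in_image[OF that(1)]
    by (intro nth_equalityI) (auto simp: nth_perm_list perm_list_in_idx[unfolded idx_def, simplified] idx_def)
  show "\<forall>xs\<in>idx n. perm_list (inv p) n (perm_list p n xs) = xs"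
    by (intro ballI *[OF permutes_inv[OF p]] permutes_inverses(1)[OF p])
  show "\<forall>xs\<in>idx n. perm_list p n (perm_list (inv p) n xs) = xs"
    by (intro ballI *[OF p] permutes_inverses(2)[OF p])
qed auto

lemma mat_mul_perm_list:
  assumes p: "p permutes {..<n}"
    and A: "\<And>k. k \<in> idx n \<Longrightarrow> A (perm_list p n xs) (perm_list p n k) = A xs k"
    and B: "\<And>k. k \<in> idx n \<Longrightarrow> B (perm_list p n k) (perm_list p n ys) = B k ys"
  shows "mat_mul (idx n) A B (perm_list p n xs) (perm_list p n ys) = mat_mul (idx n) A B xs ys"
  unfolding mat_mul_def
  using sum.reindex_bij_betw[OF bij_perm_list[OF p],
      of "\<lambda>k. A (perm_list p n xs) k * B k (perm_list p n ys)"]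
  by (simp add: A B)

lemma mat_mul_diff_adj_diff:
  "mat_mul I (\<lambda>x k. A x k - B x k) (adj (\<lambda>x k. A x k - B x k)) x y
    = mat_mul I A (adj A) x y - mat_mul I A (adj B) x y - mat_mul I B (adj A) x y + mat_mul I B (adj B) x y"
  by (simp add: mat_mul_def adj_def algebra_simps sum.distrib sum_subtractf)

text \<open>\<open>L\<close> is a generalized inverse of \<Phi>, and \<open>W\<close> applies its
  tensor power to \<Psi>. Then \<open>W\<close> times \<open>adj W\<close> is the tensor power of
  the projection \<open>adj \<Phi>\<close> \<open>E\<close> \<Phi>, and \<Phi> \<open>L\<close> =
  \<sigma> \<open>E\<close> is an idempotent whose tensor power fixes \<Psi>.\<close>

lemma exists_partial_isometry:
  fixes \<sigma> E :: "'a::finite \<Rightarrow> 'a \<Rightarrow> complex" and \<Psi> :: "'a list \<Rightarrow> 'r::finite list \<Rightarrow> complex"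
  assumes E: "adj E = E" "mat_mul UNIV \<sigma> (mat_mul UNIV E \<sigma>) = \<sigma>" "mat_mul UNIV E (mat_mul UNIV \<sigma> E) = E"
    and \<Phi>: "mat_mul UNIV \<Phi> (adj \<Phi>) = \<sigma>"
    and \<Psi>: "\<And>as bs. as \<in> idx n \<Longrightarrow> bs \<in> idx n \<Longrightarrow> mat_mul (idx n) \<Psi> (adj \<Psi>) as bs = tensor_mat n \<sigma> as bs"
    and sym: "\<And>p as rs. p permutes {..<n} \<Longrightarrow> as \<in> idx n \<Longrightarrow> rs \<in> idx n \<Longrightarrow>
       \<Psi> (perm_list p n as) (perm_list p n rs) = \<Psi> as rs"
  obtains W where "perm_invariant n W"
    "\<And>ts rs. ts \<in> idx n \<Longrightarrow> rs \<in> idx n \<Longrightarrow> mat_mul (idx n) W (mat_mul (idx n) (adj W) W) ts rs = W ts rs"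
    "\<And>as rs. as \<in> idx n \<Longrightarrow> rs \<in> idx n \<Longrightarrow> \<Psi> as rs = mat_mul (idx n) (tensor_mat n \<Phi>) W as rs"
proof -
  let ?A = "idx n :: 'a list set" and ?R = "idx n :: 'r list set"
  define L where "L = mat_mul UNIV (adj \<Phi>) E"
  define W where "W = mat_mul ?A (tensor_mat n L) \<Psi>"
  have adjL: "adj L = mat_mul UNIV E \<Phi>" by (simp add: L_def adj_mat_mul E)
  have \<Phi>L: "mat_mul UNIV \<Phi> L = mat_mul UNIV \<sigma> E" by (simp add: L_def \<Phi> flip: mat_mul_assoc)
  have LsL: "mat_mul UNIV L (mat_mul UNIV \<sigma> (adj L)) = mat_mul UNIV L \<Phi>"
  proof -
    have "mat_mul UNIV L (mat_mul UNIV \<sigma> (adj L)) = mat_mul UNIV (adj \<Phi>) (mat_mul UNIV (mat_mul UNIV E (mat_mul UNIV \<sigma> E)) \<Phi>)"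
      by (simp add: L_def adjL[unfolded L_def] mat_mul_assoc)
    then show ?thesis by (simp add: E L_def mat_mul_assoc)
  qed
  have L\<Phi>L: "mat_mul UNIV (mat_mul UNIV L \<Phi>) L = L"
    by (simp add: mat_mul_assoc \<Phi>L) (simp add: L_def mat_mul_assoc E)
  have h: "adj \<sigma> = \<sigma>" by (simp add: adj_mat_mul flip: \<Phi>)
  have adjPi: "adj (mat_mul UNIV \<sigma> E) = mat_mul UNIV E \<sigma>" by (simp add: adj_mat_mul h E)
  have WW: "mat_mul ?R W (adj W) = tensor_mat n (mat_mul UNIV L \<Phi>)"
  proof (intro ext)
    fix ts us
    have "mat_mul ?R W (adj W) ts us = mat_mul ?A (tensor_mat n L) (mat_mul ?A (mat_mul ?R \<Psi> (adj \<Psi>)) (tensor_mat n (adj L))) ts us"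
      by (simp add: W_def adj_mat_mul mat_mul_assoc adj_tensor_mat)
    also have "\<dots> = mat_mul ?A (tensor_mat n L) (mat_mul ?A (tensor_mat n \<sigma>) (tensor_mat n (adj L))) ts us"
      by (rule mat_mul_cong[OF refl], rule mat_mul_cong[OF _ refl]) (use \<Psi> in auto)
    finally show "mat_mul ?R W (adj W) ts us = tensor_mat n (mat_mul UNIV L \<Phi>) ts us"
      by (simp add: mat_mul_tensor_mat LsL)
  qed
  have W3: "mat_mul ?R W (mat_mul ?R (adj W) W) ts rs = W ts rs" for ts rs
  proof -
    have "mat_mul ?R W (mat_mul ?R (adj W) W) = mat_mul ?R (mat_mul ?R W (adj W)) W" by (simp add: mat_mul_assoc)
    also have "\<dots> = mat_mul ?A (mat_mul ?R (tensor_mat n (mat_mul UNIV L \<Phi>)) (tensor_mat n L)) \<Psi>"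
      unfolding WW by (simp add: W_def mat_mul_assoc)
    finally show ?thesis unfolding mat_mul_tensor_mat L\<Phi>L by (simp add: W_def)
  qed
  have symW: "perm_invariant n W"
    unfolding perm_invariant_def W_def
    by (intro allI impI mat_mul_perm_list) (auto simp: tensor_mat_perm_list sym)
  have "\<Psi> as rs = mat_mul ?R (tensor_mat n \<Phi>) W as rs" if as: "as \<in> ?A" and rs: "rs \<in> ?R" for as rs
  proof -
    let ?P = "tensor_mat n (mat_mul UNIV \<sigma> E)"
    \<comment> \<open>The part of \<Psi> that \<open>?P\<close> does not fix. The four terms of its
      Gram matrix all have the diagonal entry of the tensor power of \<sigma> and cancel.\<close>
    define \<Delta> where "\<Delta> = (\<lambda>as rs. \<Psi> as rs - mat_mul ?A ?P \<Psi> as rs)"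
    let ?S = "mat_mul ?R \<Psi> (adj \<Psi>)"
    have "mat_mul ?R \<Delta> (adj \<Delta>) as as = ?S as as - mat_mul ?R \<Psi> (adj (mat_mul ?A ?P \<Psi>)) as as
        - mat_mul ?R (mat_mul ?A ?P \<Psi>) (adj \<Psi>) as as + mat_mul ?R (mat_mul ?A ?P \<Psi>) (adj (mat_mul ?A ?P \<Psi>)) as as"
      unfolding \<Delta>_def by (rule mat_mul_diff_adj_diff)
    also have "mat_mul ?R \<Psi> (adj (mat_mul ?A ?P \<Psi>)) as as = mat_mul ?A ?S (tensor_mat n (mat_mul UNIV E \<sigma>)) as as"
      by (simp add: adj_mat_mul mat_mul_assoc adj_tensor_mat adjPi[unfolded adj_mat_mul])
    also have "\<dots> = mat_mul ?A (tensor_mat n \<sigma>) (tensor_mat n (mat_mul UNIV E \<sigma>)) as as"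
      by (rule mat_mul_cong[OF _ refl]) (use \<Psi> as in auto)
    also have "\<dots> = tensor_mat n \<sigma> as as" by (simp add: mat_mul_tensor_mat E)
    also have "mat_mul ?R (mat_mul ?A ?P \<Psi>) (adj \<Psi>) as as = mat_mul ?A ?P ?S as as"
      by (simp add: mat_mul_assoc)
    also have "\<dots> = mat_mul ?A ?P (tensor_mat n \<sigma>) as as"
      by (rule mat_mul_cong[OF refl]) (use \<Psi> as in auto)
    also have "\<dots> = tensor_mat n \<sigma> as as" by (simp add: mat_mul_tensor_mat mat_mul_assoc E)
    also have "mat_mul ?R (mat_mul ?A ?P \<Psi>) (adj (mat_mul ?A ?P \<Psi>)) as as
        = mat_mul ?A ?P (mat_mul ?A ?S (tensor_mat n (mat_mul UNIV E \<sigma>))) as as"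
      by (simp add: adj_mat_mul mat_mul_assoc adj_tensor_mat adjPi[unfolded adj_mat_mul])
    also have "\<dots> = mat_mul ?A ?P (mat_mul ?A (tensor_mat n \<sigma>) (tensor_mat n (mat_mul UNIV E \<sigma>))) as as"
      by (rule mat_mul_cong[OF refl], rule mat_mul_cong[OF _ refl]) (use \<Psi> as in auto)
    also have "\<dots> = tensor_mat n \<sigma> as as" by (simp add: mat_mul_tensor_mat mat_mul_assoc E)
    also have "?S as as = tensor_mat n \<sigma> as as" using \<Psi> as by simp
    finally have "mat_mul ?R \<Delta> (adj \<Delta>) as as = 0" by simp
    then have "\<Delta> as rs = 0" by (rule mat_mul_adj_eq_0[OF finite_idx _ rs])
    moreover have "mat_mul ?R (tensor_mat n \<Phi>) W = mat_mul ?A ?P \<Psi>"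
      by (simp add: W_def mat_mul_tensor_mat \<Phi>L flip: mat_mul_assoc)
    ultimately show ?thesis by (simp add: \<Delta>_def)
  qed
  then show thesis by (rule that[OF symW W3])
qed

definition as_matrix :: "complex ^ ('a::finite \<times> 'r::finite) \<Rightarrow> 'a \<Rightarrow> 'r \<Rightarrow> complex" where
  "as_matrix \<phi> a r = \<phi> $ (a, r)"

text \<open>The nonvanishing condition of \<open>purification1\<close> is kept apart, so that the
  set is visibly closed.\<close>

definition purifications :: "('a::finite \<Rightarrow> 'a \<Rightarrow> complex) \<Rightarrow> (complex ^ ('a \<times> 'r::finite)) set" where
  "purifications \<sigma> = {\<phi>. mat_mul UNIV (as_matrix \<phi>) (adj (as_matrix \<phi>)) = \<sigma>}"

lemma purification1_iff: "purification1 \<sigma> \<phi> \<longleftrightarrow> \<phi> \<noteq> 0 \<and> \<phi> \<in> purifications \<sigma>"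
  by (auto simp: purification1_def purifications_def mat_mul_def adj_def as_matrix_def fun_eq_iff)

lemma closed_purifications: "closed (purifications \<sigma> :: (complex ^ ('a::finite \<times> 'r::finite)) set)"
proof -
  have "(purifications \<sigma> :: (complex ^ ('a \<times> 'r)) set) = {\<phi>. \<forall>a a'. (\<Sum>r\<in>UNIV. \<phi> $ (a, r) * cnj (\<phi> $ (a', r))) = \<sigma> a a'}"
    by (auto simp: purifications_def mat_mul_def adj_def as_matrix_def fun_eq_iff)
  moreover have "closed {\<phi> :: complex ^ ('a \<times> 'r). \<forall>a a'. (\<Sum>r\<in>UNIV. \<phi> $ (a, r) * cnj (\<phi> $ (a', r))) = \<sigma> a a'}"
    by (intro closed_Collect_all closed_Collect_eq continuous_intros)
  ultimately show ?thesis by simp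
qed

text \<open>The squared norm of every purification is the trace of \<sigma>.\<close>

lemma compact_purifications: "compact (purifications \<sigma> :: (complex ^ ('a::finite \<times> 'r::finite)) set)"
proof -
  have "norm \<phi> \<le> sqrt (Re (\<Sum>a\<in>UNIV. \<sigma> a a))" if "\<phi> \<in> purifications \<sigma>" for \<phi> :: "complex ^ ('a \<times> 'r)"
  proof -
    have "complex_of_real (\<Sum>x\<in>UNIV. (cmod (\<phi> $ x))\<^sup>2) = (\<Sum>x\<in>UNIV. \<phi> $ x * cnj (\<phi> $ x))"
      by (simp only: of_real_sum complex_norm_square)
    also have "\<dots> = (\<Sum>a\<in>UNIV. \<Sum>r\<in>UNIV. \<phi> $ (a, r) * cnj (\<phi> $ (a, r)))"
      by (simp add: sum.cartesian_product flip: UNIV_Times_UNIV)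
    also have "\<dots> = (\<Sum>a\<in>UNIV. \<sigma> a a)"
      using that by (auto simp: purifications_def mat_mul_def adj_def as_matrix_def fun_eq_iff)
    finally have "(\<Sum>x\<in>UNIV. (cmod (\<phi> $ x))\<^sup>2) = Re (\<Sum>a\<in>UNIV. \<sigma> a a)"
      by (metis Re_complex_of_real)
    then show ?thesis by (simp add: norm_vec_def L2_set_def)
  qed
  then have "bounded (purifications \<sigma> :: (complex ^ ('a \<times> 'r)) set)" by (rule boundedI)
  then show ?thesis using closed_purifications by (simp add: compact_eq_bounded_closed)
qed

section \<open>Unitary symmetry on the purifying factor\<close>

definition rotate_R :: "('r::finite \<Rightarrow> 'r \<Rightarrow> complex) \<Rightarrow> complex ^ ('a::finite \<times> 'r) \<Rightarrow> complex ^ ('a \<times> 'r)" where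
  "rotate_R U \<phi> = (\<chi> x. \<Sum>s\<in>UNIV. U (snd x) s * \<phi> $ (fst x, s))"

lemma as_matrix_rotate_R: "as_matrix (rotate_R U \<phi>) = mat_mul UNIV (as_matrix \<phi>) (\<lambda>s r. U r s)"
  by (simp add: fun_eq_iff as_matrix_def rotate_R_def mat_mul_def mult.commute)

text \<open>Rotation is right multiplication by the transpose of \<open>U\<close>, which cancels
  against its adjoint. Hence rotations preserve the set of purifications and, taking traces,
  \<open>herm_prod\<close>.\<close>

lemma rotate_R_gram:
  assumes "mat_mul UNIV (adj U) U = id_mat"
  shows "mat_mul UNIV (as_matrix (rotate_R U \<phi>)) (adj (as_matrix (rotate_R U \<eta>))) = mat_mul UNIV (as_matrix \<phi>) (adj (as_matrix \<eta>))"
proof -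
  define T where "T = (\<lambda>s r. U r s)"
  have T: "mat_mul UNIV T (adj T) = id_mat"
  proof (intro ext)
    fix s s'
    have "mat_mul UNIV T (adj T) s s' = mat_mul UNIV (adj U) U s' s"
      by (simp add: T_def mat_mul_def adj_def mult.commute)
    then show "mat_mul UNIV T (adj T) s s' = id_mat s s'"
      using assms by (auto simp: id_mat_def)
  qed
  have "mat_mul UNIV (mat_mul UNIV (as_matrix \<phi>) T) (mat_mul UNIV (adj T) (adj (as_matrix \<eta>)))
      = mat_mul UNIV (as_matrix \<phi>) (mat_mul UNIV (mat_mul UNIV T (adj T)) (adj (as_matrix \<eta>)))"
    by (simp only: mat_mul_assoc)
  also have "mat_mul UNIV (mat_mul UNIV T (adj T)) (adj (as_matrix \<eta>)) = adj (as_matrix \<eta>)"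
    unfolding T by (simp add: fun_eq_iff)
  finally show ?thesis by (simp only: as_matrix_rotate_R adj_mat_mul T_def)
qed

lemma herm_prod_eq_trace: "herm_prod \<phi> \<eta> = (\<Sum>a\<in>UNIV. mat_mul UNIV (as_matrix \<phi>) (adj (as_matrix \<eta>)) a a)"
  by (simp add: herm_prod_def mat_mul_def as_matrix_def adj_def sum.cartesian_product flip: UNIV_Times_UNIV)

lemma tensor_vec_eq_vectorize: "xs \<in> idx n \<Longrightarrow> tensor_vec n \<phi> xs = vectorize (tensor_mat n (as_matrix \<phi>)) xs"
  by (auto simp: tensor_vec_def vectorize_def tensor_mat_def as_matrix_def idx_def intro!: prod.cong)

lemma mat_mul_conjugation_mixture:
  "mat_mul I (mat_mul J A (\<lambda>s t. \<Sum>k\<in>K. c k * (u k s * cnj (v k t)))) (adj A') x y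
    = (\<Sum>k\<in>K. c k * ((\<Sum>s\<in>J. A x s * u k s) * cnj (\<Sum>t\<in>I. A' y t * v k t)))"
proof -
  have "mat_mul I (mat_mul J A (\<lambda>s t. \<Sum>k\<in>K. c k * (u k s * cnj (v k t)))) (adj A') x y
      = (\<Sum>t\<in>I. \<Sum>s\<in>J. \<Sum>k\<in>K. c k * ((A x s * u k s) * cnj (A' y t * v k t)))"
    by (simp add: mat_mul_def adj_def sum_distrib_left sum_distrib_right mult_ac)
  also have "\<dots> = (\<Sum>t\<in>I. \<Sum>k\<in>K. \<Sum>s\<in>J. c k * ((A x s * u k s) * cnj (A' y t * v k t)))"
    by (intro sum.cong[OF refl] sum.swap)
  also have "\<dots> = (\<Sum>k\<in>K. \<Sum>t\<in>I. \<Sum>s\<in>J. c k * ((A x s * u k s) * cnj (A' y t * v k t)))"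
    by (rule sum.swap)
  also have "\<dots> = (\<Sum>k\<in>K. \<Sum>s\<in>J. \<Sum>t\<in>I. c k * ((A x s * u k s) * cnj (A' y t * v k t)))"
    by (intro sum.cong[OF refl] sum.swap)
  also have "\<dots> = (\<Sum>k\<in>K. c k * ((\<Sum>s\<in>J. A x s * u k s) * cnj (\<Sum>t\<in>I. A' y t * v k t)))"
    by (simp only: cnj_sum sum_product) (simp only: sum_distrib_left)
  finally show ?thesis .
qed

text \<open>Rotating all atoms conjugates each block by the tensor power of \<open>U\<close>.
  Invariance therefore says that the block equals its conjugate, and multiplying by that power on
  the right gives commutation.\<close>

lemma invariant_mixture_commutes:
  fixes f :: "nat \<Rightarrow> complex ^ ('a::finite \<times> 'r::finite)" and w :: "nat \<Rightarrow> real" and m n :: nat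
  defines "M \<equiv> mixture m w (\<lambda>k. tensor_vec n (f k))"
  assumes U: "mat_mul UNIV (adj U) U = id_mat"
    and inv: "\<forall>i\<in>idx n. \<forall>j\<in>idx n. mixture m w (\<lambda>k. tensor_vec n (rotate_R U (f k))) i j = M i j"
    and as: "as \<in> idx n" and bs: "bs \<in> idx n"
  shows "commutes n (block M as bs) (tensor_mat n U)"
proof -
  let ?R = "idx n :: 'r list set"
  let ?N = "block M as bs"
  let ?T = "tensor_mat n U"
  have N: "?N rs ss = (\<Sum>k<m. of_real (w k) * (tensor_mat n (as_matrix (f k)) as rs * cnj (tensor_mat n (as_matrix (f k)) bs ss)))"
    if "rs \<in> ?R" "ss \<in> ?R" for rs ss
    using that as bs by (simp add: block_def M_def mixture_def tensor_vec_eq_vectorize)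
  have rot: "tensor_mat n (as_matrix (rotate_R U \<phi>)) cs rs = (\<Sum>t\<in>?R. ?T rs t * tensor_mat n (as_matrix \<phi>) cs t)"
    for cs rs and \<phi> :: "complex ^ ('a \<times> 'r)"
  proof -
    have "tensor_mat n (as_matrix (rotate_R U \<phi>)) cs rs = mat_mul ?R (tensor_mat n (as_matrix \<phi>)) (tensor_mat n (\<lambda>s r. U r s)) cs rs"
      by (simp add: as_matrix_rotate_R mat_mul_tensor_mat)
    then show ?thesis by (simp add: mat_mul_def tensor_mat_def mult.commute)
  qed
  have conj: "?N rs ss = mat_mul ?R (mat_mul ?R ?T ?N) (adj ?T) rs ss" if rs: "rs \<in> ?R" "ss \<in> ?R" for rs ss
  proof -
    have "mat_mul ?R (mat_mul ?R ?T ?N) (adj ?T) rs ss = mat_mul ?R (mat_mul ?R ?T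
        (\<lambda>rs ss. \<Sum>k<m. of_real (w k) * (tensor_mat n (as_matrix (f k)) as rs * cnj (tensor_mat n (as_matrix (f k)) bs ss)))) (adj ?T) rs ss"
      by (rule mat_mul_cong[OF _ refl], rule mat_mul_cong[OF refl]) (rule N)
    also have "\<dots> = mixture m w (\<lambda>k. tensor_vec n (rotate_R U (f k))) (zip as rs) (zip bs ss)"
      unfolding mat_mul_conjugation_mixture using rs as bs by (simp add: mixture_def tensor_vec_eq_vectorize rot)
    also have "\<dots> = ?N rs ss" using inv rs as bs by (simp add: block_def)
    finally show ?thesis by simp
  qed
  show ?thesis
    unfolding commutes_def
  proof (intro ballI)
    fix rs ss assume rs: "rs \<in> ?R" "ss \<in> ?R"
    have "mat_mul ?R ?N ?T rs ss = mat_mul ?R (mat_mul ?R (mat_mul ?R ?T ?N) (adj ?T)) ?T rs ss"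
      by (rule mat_mul_cong[OF _ refl]) (use conj rs in auto)
    also have "\<dots> = mat_mul ?R ?T (mat_mul ?R ?N (tensor_mat n id_mat)) rs ss"
      by (simp add: mat_mul_assoc adj_tensor_mat mat_mul_tensor_mat U)
    also have "\<dots> = mat_mul ?R ?T (mat_mul ?R ?N id_mat) rs ss"
      by (rule mat_mul_cong[OF refl], rule mat_mul_cong[OF refl]) (use rs tensor_mat_id_mat in auto)
    also have "\<dots> = mat_mul ?R ?T ?N rs ss"
      by (rule mat_mul_cong[OF refl]) (use rs in auto)
    finally show "mat_mul ?R ?T ?N rs ss = mat_mul ?R ?N ?T rs ss" by simp
  qed
qed

text \<open>The columns of the factor \<open>Y\<close> are placed at distinct basis vectors of R,
  and all other columns are zero.\<close>

lemma purifications_nonempty: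
  fixes Y :: "'a::finite \<Rightarrow> nat \<Rightarrow> complex"
  assumes m: "m \<le> CARD('r::finite)" and Y: "mat_mul {..<m} Y (adj Y) = \<sigma>"
  shows "purifications \<sigma> \<noteq> ({} :: (complex ^ ('a \<times> 'r)) set)"
proof -
  obtain h :: "nat \<Rightarrow> 'r" where h: "inj_on h {..<m}"
    using card_le_inj[of "{..<m}" "UNIV :: 'r set"] m by auto
  define \<phi> :: "complex ^ ('a \<times> 'r)" where
    "\<phi> = (\<chi> x. if snd x \<in> h ` {..<m} then Y (fst x) (inv_into {..<m} h (snd x)) else 0)"
  have "mat_mul UNIV (as_matrix \<phi>) (adj (as_matrix \<phi>)) a b = \<sigma> a b" for a b
  proof -
    have "mat_mul UNIV (as_matrix \<phi>) (adj (as_matrix \<phi>)) a b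
       = (\<Sum>s\<in>h ` {..<m}. Y a (inv_into {..<m} h s) * cnj (Y b (inv_into {..<m} h s)))"
      unfolding mat_mul_def adj_def as_matrix_def \<phi>_def
      by (intro sum.mono_neutral_cong_right) auto
    also have "\<dots> = (\<Sum>k<m. Y a k * cnj (Y b k))"
      using h by (simp add: sum.reindex)
    finally show ?thesis by (simp add: Y[symmetric] mat_mul_def adj_def)
  qed
  then have "\<phi> \<in> purifications \<sigma>" by (auto simp: purifications_def fun_eq_iff)
  then show ?thesis by blast
qed

text \<open>Pushing the weights forward along \<open>f\<close> allows repeated atoms, so integrals
  are the sums over \<open>k\<close> without collecting equal points.\<close>

lemma finite_mixture_measure:
  fixes f :: "nat \<Rightarrow> 'v::{second_countable_topology, topological_space}"
  assumes w: "\<And>k. 0 \<le> w k" "(\<Sum>k<m. w k) = 1"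
  defines "M \<equiv> distr (point_measure {..<m} (\<lambda>k. ennreal (w k))) borel f"
  shows "prob_space M" "sets M = sets borel"
    "closed K \<Longrightarrow> (\<And>k. f k \<in> K) \<Longrightarrow> AE \<phi> in M. \<phi> \<in> K"
    "continuous_on UNIV F \<Longrightarrow> integrable M F"
    "continuous_on UNIV F \<Longrightarrow> integral\<^sup>L M F = (\<Sum>k<m. of_real (w k) * (F (f k) :: complex))"
proof -
  let ?P = "point_measure {..<m} (\<lambda>k. ennreal (w k))"
  have meas: "f \<in> measurable ?P borel" by simp
  have "emeasure ?P (space ?P) = ennreal (\<Sum>k<m. w k)"
    using w(1) by (simp add: space_point_measure emeasure_point_measure_finite sum_ennreal)
  then have "prob_space ?P" using w(2) by (intro prob_spaceI) simp
  then show "prob_space M" unfolding M_def by (rule prob_space.prob_space_distr[OF _ meas])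
  show "sets M = sets borel" by (simp add: M_def)
  show "AE \<phi> in M. \<phi> \<in> K" if "closed K" "\<And>k. f k \<in> K"
    unfolding M_def using that
    by (subst AE_distr_iff[OF meas]) (auto simp: borel_closed)
  have Fm: "F \<in> borel_measurable borel" if "continuous_on UNIV F" for F :: "'v \<Rightarrow> complex"
    using that by (rule borel_measurable_continuous_onI)
  show "integrable M F" if "continuous_on UNIV F"
    unfolding M_def integrable_distr_eq[OF meas Fm[OF that]] by (rule integrable_point_measure_finite) simp
  show "integral\<^sup>L M F = (\<Sum>k<m. of_real (w k) * (F (f k) :: complex))" if "continuous_on UNIV F"
    unfolding M_def integral_distr[OF meas Fm[OF that]]
    using w(1) by (subst lebesgue_integral_point_measure_finite) (auto simp: scaleR_conv_of_real)
qed

section \<open>Construction of the dominating measure\<close>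

theorem theorem1:
  fixes \<sigma> :: "'a::finite \<Rightarrow> 'a \<Rightarrow> complex"
    and \<rho> :: "('a \<times> 'r::finite) list \<Rightarrow> ('a \<times> 'r) list \<Rightarrow> complex"
    and n :: nat
  assumes "n > 0"
    and "psd_on UNIV \<sigma>"
    and "purification_n n \<sigma> \<rho>"
    and "supported_on_sym n \<rho>"
  shows "\<exists>M :: (complex ^ ('a \<times> 'r)) measure.
           prob_space M \<and> sets M = sets borel \<and>
           (AE \<phi> in M. purification1 \<sigma> \<phi>) \<and>
           (\<forall>i j. integrable M (\<lambda>\<phi>. tpow n (outer1 \<phi>) i j)) \<and>
           psd_on (idx n) (\<lambda>i j. of_nat (g n (CARD('a) * CARD('r))) *
                (\<integral>\<phi>. tpow n (outer1 \<phi>) i j \<partial>M) - \<rho> i j)"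
proof -
  let ?A = "idx n :: 'a list set" and ?R = "idx n :: 'r list set"
  obtain \<psi> i0 where \<psi>: "\<And>i j. i \<in> idx n \<Longrightarrow> j \<in> idx n \<Longrightarrow> \<rho> i j = \<psi> i * cnj (\<psi> j)"
    and i0: "i0 \<in> idx n" "\<psi> i0 \<noteq> 0"
    and tr: "\<And>as bs. as \<in> idx n \<Longrightarrow> bs \<in> idx n \<Longrightarrow> ptrace_Rn n \<rho> as bs = tpow n \<sigma> as bs"
    using assms(3) unfolding purification_n_def by blast
  define \<Psi> where "\<Psi> = (\<lambda>as rs. \<psi> (zip as rs))"
  have \<Psi>: "mat_mul ?R \<Psi> (adj \<Psi>) as bs = tensor_mat n \<sigma> as bs" if "as \<in> ?A" "bs \<in> ?A" for as bs
    using tr[OF that] that by (simp add: ptrace_Rn_def \<psi> mat_mul_def adj_def \<Psi>_def tpow_eq_tensor_mat)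
  have sym: "\<Psi> (perm_list p n as) (perm_list p n rs) = \<Psi> as rs"
    if p: "p permutes {..<n}" and as: "as \<in> ?A" and rs: "rs \<in> ?R" for p as rs
  proof -
    let ?z = "zip as rs"
    have pz: "zip (perm_list p n as) (perm_list p n rs) = perm_list p n ?z"
      using as rs permutes_in_image[OF p]
      by (intro nth_equalityI) (auto simp: perm_list_def idx_def)
    \<comment> \<open>The column of \<rho> at \<open>i0\<close> is a nonzero multiple of \<psi>, so
      its symmetry passes to \<psi>.\<close>
    have "in_sym n (\<lambda>i. \<rho> i i0)" using assms(4) i0 by (simp add: supported_on_sym_def)
    then have "\<rho> (perm_list p n ?z) i0 = \<rho> ?z i0"
      using p as rs unfolding in_sym_def perm_list_def[symmetric] by simp
    then have "\<psi> (perm_list p n ?z) = \<psi> ?z" using i0 as rs by (simp add: \<psi>)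
    then show ?thesis by (simp add: \<Psi>_def pz)
  qed
  \<comment> \<open>If zero purified \<sigma>, then \<sigma> and, as \<open>n > 0\<close>, its
    tensor power would vanish, and \<psi> with them.\<close>
  have nz: "\<phi> \<noteq> 0" if "\<phi> \<in> purifications \<sigma>" for \<phi> :: "complex ^ ('a \<times> 'r)"
  proof
    assume "\<phi> = 0"
    then have "\<sigma> a b = 0" for a b using that by (auto simp: purifications_def mat_mul_def as_matrix_def)
    then have "tensor_mat n \<sigma> as bs = 0" for as bs using assms(1) by (auto simp: tensor_mat_def)
    moreover have i0_split: "map fst i0 \<in> ?A" "map snd i0 \<in> ?R" using i0(1) by (auto simp: idx_def)
    ultimately have "mat_mul ?R \<Psi> (adj \<Psi>) (map fst i0) (map fst i0) = 0" by (simp add: \<Psi>)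
    then have "\<Psi> (map fst i0) (map snd i0) = 0" by (rule mat_mul_adj_eq_0[OF finite_idx _ i0_split(2)])
    then show False using i0(2) by (simp add: \<Psi>_def zip_map_fst_snd)
  qed
  \<comment> \<open>The given purification of the tensor power bounds the rank of \<sigma> by the
    dimension of R, so \<sigma> itself has a purification with this R.\<close>
  have bd: "m \<le> CARD('r)" if "orthonormal UNIV \<sigma> m e" for m e
    by (rule orthonormal_system_le_card[OF assms(1) _ that]) (rule \<Psi>)
  obtain m0 Z where m0: "m0 \<le> CARD('r)"
    and Z: "mat_mul {..<m0} (mat_mul UNIV \<sigma> Z) (adj (mat_mul UNIV \<sigma> Z)) = \<sigma>"
    and E: "mat_mul UNIV \<sigma> (mat_mul UNIV (mat_mul {..<m0} Z (adj Z)) \<sigma>) = \<sigma>"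
      "mat_mul UNIV (mat_mul {..<m0} Z (adj Z)) (mat_mul UNIV \<sigma> (mat_mul {..<m0} Z (adj Z))) = mat_mul {..<m0} Z (adj Z)"
    by (rule psd_generalized_inverse[OF assms(2) bd]) (assumption, rule that, assumption+)
  have adjE: "adj (mat_mul {..<m0} Z (adj Z)) = mat_mul {..<m0} Z (adj Z)" by (simp add: adj_mat_mul)
  have ne: "purifications \<sigma> \<noteq> ({} :: (complex ^ ('a \<times> 'r)) set)" by (rule purifications_nonempty[OF m0 Z])
  obtain m w and f :: "nat \<Rightarrow> complex ^ ('a \<times> 'r)" where w: "\<And>k. 0 \<le> w k" "(\<Sum>k<m. w k) = 1"
    and f: "\<And>k. f k \<in> purifications \<sigma>"
    and inv: "\<forall>T. (\<forall>\<phi>\<in>purifications \<sigma>. T \<phi> \<in> purifications \<sigma>) \<longrightarrow>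
      (\<forall>\<phi>\<in>purifications \<sigma>. \<forall>\<eta>\<in>purifications \<sigma>. herm_prod (T \<phi>) (T \<eta>) = herm_prod \<phi> \<eta>) \<longrightarrow>
      (\<forall>i\<in>idx n. \<forall>j\<in>idx n. mixture m w (\<lambda>k. tensor_vec n (T (f k))) i j = mixture m w (\<lambda>k. tensor_vec n (f k)) i j)"
    using exists_invariant_mixture[OF compact_purifications ne, of n] by (elim exE conjE) (rule that, auto)
  define M where "M = mixture m w (\<lambda>k. tensor_vec n (f k))"
  have commU: "commutes n (block M as bs) (tensor_mat n U)"
    if "as \<in> ?A" "bs \<in> ?A" "mat_mul UNIV (adj U) U = id_mat" for as bs U
    unfolding M_def
  proof (rule invariant_mixture_commutes[OF that(3) _ that(1,2)])
    show "\<forall>i\<in>idx n. \<forall>j\<in>idx n. mixture m w (\<lambda>k. tensor_vec n (rotate_R U (f k))) i j = mixture m w (\<lambda>k. tensor_vec n (f k)) i j"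
      by (rule inv[THEN spec, THEN mp, THEN mp]) (simp_all add: purifications_def herm_prod_eq_trace rotate_R_gram[OF that(3)])
  qed
  have comm: "\<forall>as\<in>?A. \<forall>bs\<in>?A. \<forall>B. perm_invariant n B \<longrightarrow> commutes n (block M as bs) B"
  proof (intro ballI allI impI)
    fix as bs :: "'a list" and B :: "'r list \<Rightarrow> 'r list \<Rightarrow> complex"
    assume ab: "as \<in> ?A" "bs \<in> ?A" and B: "perm_invariant n B"
    show "commutes n (block M as bs) B"
    proof (rule commutes_symmetric)
      show "commutes n (block M as bs) (tensor_mat n U)" if "mat_mul UNIV (adj U) U = id_mat" for U
        by (rule commU[OF ab that])
    qed (use B in \<open>simp add: perm_invariant_def\<close>)
  qed
  have psdM: "psd_on (idx n) M" unfolding M_def by (rule psd_mixture) (rule w)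
  have "\<exists>k<m. \<forall>x. (cmod (inner_idx n x (tensor_vec n (f k))))\<^sup>2
      \<le> real (g n CARD('a \<times> 'r)) * Re (sesq_form (idx n) M x x)"
    unfolding M_def by (rule exists_low_leverage_atom) (simp_all add: w in_sym_tensor_vec)
  then obtain k where k: "\<And>x. (cmod (inner_idx n x (tensor_vec n (f k))))\<^sup>2
      \<le> real (g n CARD('a \<times> 'r)) * Re (sesq_form (idx n) M x x)"
    by (elim exE conjE) (rule that, erule spec)
  \<comment> \<open>The partial isometry leads from the selected atom \<open>f k\<close> to \<psi>
    and carries its bound over.\<close>
  obtain W where W: "perm_invariant n W"
    "\<And>ts rs. ts \<in> idx n \<Longrightarrow> rs \<in> idx n \<Longrightarrow> mat_mul (idx n) W (mat_mul (idx n) (adj W) W) ts rs = W ts rs"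
    "\<And>as rs. as \<in> idx n \<Longrightarrow> rs \<in> idx n \<Longrightarrow> \<Psi> as rs = mat_mul (idx n) (tensor_mat n (as_matrix (f k))) W as rs"
  proof (rule exists_partial_isometry[OF adjE E, of "as_matrix (f k)" n \<Psi>])
    show "mat_mul UNIV (as_matrix (f k)) (adj (as_matrix (f k))) = \<sigma>" using f[of k] by (simp add: purifications_def)
  qed (use \<Psi> sym that in auto)
  have ip_vc: "inner_idx n x (vectorize (tensor_mat n (as_matrix (f k)))) = inner_idx n x (tensor_vec n (f k))" for x
    unfolding inner_idx_def by (intro sum.cong) (auto simp: tensor_vec_eq_vectorize)
  have ip_\<psi>: "inner_idx n x (vectorize \<Psi>) = inner_idx n x \<psi>" for x
    unfolding inner_idx_def \<Psi>_def by (intro sum.cong) (auto simp: vectorize_unzip)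
  have dom: "(cmod (inner_idx n x \<psi>))\<^sup>2 \<le> real (g n CARD('a \<times> 'r)) * Re (sesq_form (idx n) M x x)" for x
    using domination_transfer[OF comm psdM W, of "real (g n CARD('a \<times> 'r))" x] k
    by (simp add: ip_vc ip_\<psi>)
  define \<mu> where "\<mu> = distr (point_measure {..<m} (\<lambda>k. ennreal (w k))) borel f"
  note \<mu> = finite_mixture_measure[where f = f, OF w, folded \<mu>_def]
  have cont: "continuous_on UNIV (\<lambda>\<phi> :: complex ^ ('a \<times> 'r). tpow n (outer1 \<phi>) i j)" for i j
    unfolding tpow_outer1 tensor_vec_def by (intro continuous_intros)
  have int: "(\<integral>\<phi>. tpow n (outer1 \<phi>) i j \<partial>\<mu>) = M i j" for i j
    unfolding \<mu>(5)[OF cont] M_def mixture_def by (simp add: tpow_outer1)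
  have "psd_on (idx n) (\<lambda>i j. of_nat (g n (CARD('a) * CARD('r))) * (\<integral>\<phi>. tpow n (outer1 \<phi>) i j \<partial>\<mu>) - \<rho> i j)"
    unfolding psd_on_def int
  proof
    fix v :: "('a \<times> 'r) list \<Rightarrow> complex"
    let ?g = "g n (CARD('a) * CARD('r))"
    \<comment> \<open>The difference of operators has at \<open>v\<close> the real value
      \<open>?g * s\<close> minus the squared overlap of \<open>v\<close> with \<psi>, nonnegative
      by \<open>dom\<close>.\<close>
    define s where "s = (\<Sum>k<m. w k * (cmod (inner_idx n v (tensor_vec n (f k))))\<^sup>2)"
    have s: "sesq_form (idx n) M v v = of_real s" unfolding M_def sesq_form_mixture_self s_def ..
    have "(\<Sum>i\<in>idx n. \<Sum>j\<in>idx n. cnj (v i) * (of_nat ?g * M i j - \<rho> i j) * v j)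
        = (\<Sum>i\<in>idx n. \<Sum>j\<in>idx n. of_nat ?g * (cnj (v i) * M i j * v j)
            - (cnj (v i) * \<psi> i) * cnj (cnj (v j) * \<psi> j))"
      by (intro sum.cong refl) (simp add: \<psi> algebra_simps)
    also have "\<dots> = of_nat ?g * sesq_form (idx n) M v v - inner_idx n v \<psi> * cnj (inner_idx n v \<psi>)"
      by (simp add: sum_subtractf sesq_form_def inner_idx_def sum_product flip: sum_distrib_left)
    also have "\<dots> = of_real (real ?g * s - (cmod (inner_idx n v \<psi>))\<^sup>2)"
      by (simp add: s complex_norm_square[symmetric] del: of_real_power)
    finally have eq: "(\<Sum>i\<in>idx n. \<Sum>j\<in>idx n. cnj (v i) * (of_nat ?g * M i j - \<rho> i j) * v j)
        = of_real (real ?g * s - (cmod (inner_idx n v \<psi>))\<^sup>2)" .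
    have "0 \<le> real ?g * s - (cmod (inner_idx n v \<psi>))\<^sup>2" using dom[of v] by (simp add: s)
    then show "0 \<le> (\<Sum>i\<in>idx n. \<Sum>j\<in>idx n. cnj (v i) * (of_nat ?g * M i j - \<rho> i j) * v j)"
      unfolding eq less_eq_complex_def by simp
  qed
  moreover have "AE \<phi> in \<mu>. purification1 \<sigma> \<phi>"
    using \<mu>(3)[OF closed_purifications f] by (rule AE_mp) (auto simp: purification1_iff nz)
  ultimately show ?thesis using \<mu>(1,2) \<mu>(4)[OF cont] by blast
qed

end
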